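(* There exist sequences $\{\epsilon_j\}_{j\ge1}$ with $0<\epsilon_j<1$ and $\{c_j\}_{j\ge1}$ with $c_j>0$, satisfying $\sum_{j}\epsilon_j<\infty$ and $\sum_j c_j/\epsilon_j<\infty$, such that, with $a_j=1-\epsilon_j$ and with $\omega$, $\gamma_0$, $L$, $W$, $\ell$, $p$ the objects determined by these sequences as defined in the context, $$\widehat{\gamma_0}=W\cup\{\ell,p\}\qquad\text{and}\qquad\overline{(\widehat{\gamma_0})}=W\cup L,$$ where the bar denotes closure in $\mathbf{P}^2$.
   Context: Let $\mathbf{C}^2\subset\mathbf{P}^2$ be the standard affine chart with coordinates $(z,w)$ and let $H=\mathbf{P}^2\setminus\mathbf{C}^2$ be the line at infinity. Given sequences $\epsilon_j\in(0,1)$ and $c_j>0$ with $\sum_j\epsilon_j<\infty$ and $\sum_jc_j/\epsilon_j<\infty$, put $a_j=1-\epsilon_j$ and $$\omega(\zeta)=\sum_{j=1}^\infty\frac{c_j}{\zeta-a_j}+\sum_{j=1}^\infty\frac{c_j}{a_j}.$$ This series converges absolutely and uniformly on $\{|\zeta|\ge1\}$ (including $\zeta=1$) and uniformly on compact subsets of $\mathbf{C}\setminus(\{1\}\cup\bigcup_j\{a_j\})$. Define: - $\gamma_0=\{(\zeta,\omega(\zeta)):|\zeta|=1\}\subset\mathbf{C}^2$, a closed curve; - $L\subset\mathbf{P}^2$, the projective line which is the closure of $\{z=1\}$; - $W$, the closure in $\mathbf{P}^2\setminus L$ of the graph $\{(\zeta,\omega(\zeta)):\zeta\in\mathbf{C}\setminus(\{1\}\cup\bigcup_j\{a_j\})\}$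 with the points on $L$ excluded; - $\ell\in H$, the point at infinity common to all vertical lines $\{z=\text{const}\}$ (so $\ell\in L$); - $p=(1,\omega(1))\in L$. Projective hull: for a compact set $\gamma\subset\mathbf{P}^n$, $\widehat{\gamma}$ is the set of points $x\in\mathbf{P}^n$ for which there is a constant $C=C(x)>0$ such that $\|\mathcal{P}(x)\|\le C^d\sup_\gamma\|\mathcal{P}\|$ for all $d\ge1$ and all holomorphic sections $\mathcal{P}\in H^0(\mathbf{P}^n,\mathcal{O}(d))$, where $\|\cdot\|$ is the standard (Fubini–Study) metric on $\mathcal{O}(d)$. When $\gamma\subset\mathbf{C}^n$, a point $z\in\mathbf{C}^n$ lies in $\widehat\gamma$ if and only if there is a constant $C>0$ with $|P(z)|\le C^d\sup_\gamma|P|$ for all $d\geq 1$ and all polynomials $P$ on $\mathbf{C}^n$ of degree $\le d$. *)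

theory Defs
  imports "HOL-Analysis.Analysis"
begin

section \<open>Complex projective space\<close>

definition cproj_rel :: "complex ^ 'n \<Rightarrow> complex ^ 'n \<Rightarrow> bool" where
  "cproj_rel u v \<longleftrightarrow> u \<noteq> 0 \<and> v \<noteq> 0 \<and> (\<exists>c. c \<noteq> 0 \<and> v = c *s u)"

lemma part_equivp_cproj_rel: "part_equivp (cproj_rel :: complex ^ 'n \<Rightarrow> _)"
proof (rule part_equivpI)
  have "cproj_rel (1 :: complex ^ 'n) 1"
    unfolding cproj_rel_def by (auto intro!: exI[of _ 1])
  then show "\<exists>x :: complex ^ 'n. cproj_rel x x" ..
  show "symp (cproj_rel :: complex ^ 'n \<Rightarrow> _)"
  proof (rule sympI)
    fix u v :: "complex ^ 'n"
    assume "cproj_rel u v"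
    then obtain c where "u \<noteq> 0" "v \<noteq> 0" "c \<noteq> 0" "v = c *s u"
      unfolding cproj_rel_def by blast
    then show "cproj_rel v u"
      unfolding cproj_rel_def by (auto intro!: exI[of _ "inverse c"])
  qed
  show "transp (cproj_rel :: complex ^ 'n \<Rightarrow> _)"
  proof (rule transpI)
    fix u v w :: "complex ^ 'n"
    assume "cproj_rel u v" "cproj_rel v w"
    then obtain c d where "u \<noteq> 0" "w \<noteq> 0" "c \<noteq> 0" "v = c *s u" "d \<noteq> 0" "w = d *s v"
      unfolding cproj_rel_def by blast
    then show "cproj_rel u w"
      unfolding cproj_rel_def by (auto intro!: exI[of _ "d * c"])
  qed
qed

text \<open>
  The index type counts homogeneous coordinates, so projective n-space is the instance
  with n + 1 indices; the projective plane is \<open>3 cproj\<close>.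
  The value \<open>cproj_of 0\<close> is junk.
\<close>

quotient_type 'n cproj = "complex ^ 'n :: finite" / partial: cproj_rel
  morphisms cproj_rep cproj_of
  by (rule part_equivp_cproj_rel)

lemma cproj_of_eq_iff:
  assumes "u \<noteq> 0" "v \<noteq> 0"
  shows "cproj_of u = cproj_of v \<longleftrightarrow> (\<exists>c. c \<noteq> 0 \<and> v = c *s u)"
proof -
  have refl: "cproj_rel x x" if "x \<noteq> 0" for x :: "complex ^ 'n"
    using that unfolding cproj_rel_def by (auto intro!: exI[of _ 1])
  have "cproj_of u = cproj_of v \<longleftrightarrow> cproj_rel u v"
    using Quotient3_rel[OF Quotient3_cproj, of u v] refl assms by blast
  then show ?thesis
    using assms by (simp add: cproj_rel_def)
qed

lemma cproj_rep_nonzero: "cproj_rep x \<noteq> 0"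
  using Quotient3_rep_reflp[OF Quotient3_cproj, of x] by (simp add: cproj_rel_def)

lemma cproj_of_rep [simp]: "cproj_of (cproj_rep x) = x"
  by (rule Quotient3_abs_rep[OF Quotient3_cproj])

text \<open>The quotient topology of the punctured vector space.\<close>

instantiation cproj :: (finite) topological_space
begin

definition open_cproj :: "'a cproj set \<Rightarrow> bool" where
  "open_cproj U \<longleftrightarrow> open {v. v \<noteq> 0 \<and> cproj_of v \<in> U}"

instance
proof
  have "{v :: complex ^ 'a. v \<noteq> 0} = - {0}" by auto
  then show "open (UNIV :: 'a cproj set)"
    by (simp add: open_cproj_def open_Compl)
next
  fix S T :: "'a cproj set"
  assume "open S" "open T"
  moreover have "{v. v \<noteq> 0 \<and> cproj_of v \<in> S \<inter> T}
      = {v. v \<noteq> 0 \<and> cproj_of v \<in> S} \<inter> {v. v \<noteq> 0 \<and> cproj_of v \<in> T}"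
    by auto
  ultimately show "open (S \<inter> T)"
    by (simp add: open_cproj_def open_Int)
next
  fix K :: "'a cproj set set"
  assume "\<forall>S\<in>K. open S"
  moreover have "{v. v \<noteq> 0 \<and> cproj_of v \<in> \<Union>K}
      = (\<Union>S\<in>K. {v. v \<noteq> 0 \<and> cproj_of v \<in> S})"
    by auto
  ultimately show "open (\<Union>K)"
    unfolding open_cproj_def by auto
qed

end


section \<open>Projective hulls\<close>

definition holomorphic_off_0 :: "(complex ^ 'n \<Rightarrow> complex) \<Rightarrow> bool" where
  "holomorphic_off_0 F \<longleftrightarrow>
     (\<forall>v. v \<noteq> 0 \<longrightarrow>
       (\<exists>F'. (F has_derivative F') (at v) \<and> (\<forall>c u. F' (c *s u) = c * F' u)))"

text \<open>
  The bundle O(d) is the quotient of the product of the punctured vector space with the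
  complex numbers by the relation identifying (v, t) with (c v, c^d t) for nonzero c.
  A holomorphic section of O(d) is therefore a holomorphic function on the punctured vector
  space that is homogeneous of degree d.  Its value at 0 is irrelevant.
\<close>

definition sections_O :: "nat \<Rightarrow> (complex ^ 'n \<Rightarrow> complex) set" where
  "sections_O d = {F. holomorphic_off_0 F \<and>
     (\<forall>v c. v \<noteq> 0 \<longrightarrow> c \<noteq> 0 \<longrightarrow> F (c *s v) = c ^ d * F v)}"

text \<open>
  The Fubini-Study norm of a section at a point.  For sections of O(d) it does not depend on
  the chosen representative, see \<open>section_norm_cproj_of\<close>.
\<close>

definition section_norm ::
    "nat \<Rightarrow> (complex ^ 'n :: finite \<Rightarrow> complex) \<Rightarrow> 'n cproj \<Rightarrow> real" where
  "section_norm d F x = cmod (F (cproj_rep x)) / norm (cproj_rep x) ^ d"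

lemma norm_vector_scalar_mult: "norm (c *s v) = cmod c * norm v" for v :: "complex ^ 'n"
  by (simp add: norm_vec_def L2_set_right_distrib norm_mult)

lemma section_norm_cproj_of:
  assumes "F \<in> sections_O d" "v \<noteq> 0"
  shows "section_norm d F (cproj_of v) = cmod (F v) / norm v ^ d"
proof -
  let ?u = "cproj_rep (cproj_of v)"
  have "?u \<noteq> 0"
    by (rule cproj_rep_nonzero)
  then obtain c where c: "c \<noteq> 0" "?u = c *s v"
    using cproj_of_eq_iff[of v ?u] assms(2) by auto
  then have "F ?u = c ^ d * F v"
    using assms by (auto simp: sections_O_def)
  then show ?thesis
    using c by (simp add: section_norm_def norm_vector_scalar_mult norm_mult norm_power
        power_mult_distrib)
qed

text \<open>
  Intended for nonempty compact \<open>K\<close>, on which section norms are bounded, so that the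
  supremum is a genuine one.
\<close>

definition projective_hull :: "'n :: finite cproj set \<Rightarrow> 'n cproj set" where
  "projective_hull K = {x. \<exists>C>0. \<forall>d\<ge>1. \<forall>F\<in>sections_O d.
     section_norm d F x \<le> C ^ d * (SUP y\<in>K. section_norm d F y)}"


section \<open>The projective plane\<close>

definition affine_pt :: "complex \<Rightarrow> complex \<Rightarrow> 3 cproj" where
  "affine_pt z w = cproj_of (vector [1, z, w])"

definition line_at_infinity :: "3 cproj set" where
  "line_at_infinity = - {affine_pt z w | z w. True}"

definition vertical_line :: "complex \<Rightarrow> 3 cproj set" where
  "vertical_line z = {affine_pt z w | w. True}"

definition line_L :: "3 cproj set" where
  "line_L = closure (vertical_line 1)"

definition pt_ell :: "3 cproj" where
  "pt_ell = cproj_of (vector [0, 0, 1])"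

lemma vector3_nonzero:
  "vector [a, b, c] \<noteq> (0 :: complex ^ 3) \<longleftrightarrow> a \<noteq> 0 \<or> b \<noteq> 0 \<or> c \<noteq> 0"
  by (simp add: vec_eq_iff forall_3)

lemma cproj_of_eq_affine_pt_iff:
  assumes "v \<noteq> 0"
  shows "cproj_of v = affine_pt z w \<longleftrightarrow> v $ 1 \<noteq> 0 \<and> v $ 2 = z * v $ 1 \<and> v $ 3 = w * v $ 1"
proof -
  have "affine_pt z w = cproj_of v \<longleftrightarrow> (\<exists>c. c \<noteq> 0 \<and> v = c *s vector [1, z, w])"
    unfolding affine_pt_def by (rule cproj_of_eq_iff) (use assms in \<open>simp_all add: vector3_nonzero\<close>)
  also have "\<dots> \<longleftrightarrow> v $ 1 \<noteq> 0 \<and> v $ 2 = z * v $ 1 \<and> v $ 3 = w * v $ 1"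
    by (auto simp: vec_eq_iff forall_3)
  finally show ?thesis by auto
qed

lemma cproj_of_in_line_at_infinity_iff:
  assumes "v \<noteq> 0"
  shows "cproj_of v \<in> line_at_infinity \<longleftrightarrow> v $ 1 = 0"
proof -
  have "cproj_of v \<notin> line_at_infinity \<longleftrightarrow> (\<exists>z w. cproj_of v = affine_pt z w)"
    by (auto simp: line_at_infinity_def)
  also have "\<dots> \<longleftrightarrow> v $ 1 \<noteq> 0"
    using assms by (auto simp: cproj_of_eq_affine_pt_iff intro: exI[of _ "v $ _ / v $ 1"])
  finally show ?thesis by auto
qed

lemma line_at_infinity_inter_vertical_line:
  "line_at_infinity \<inter> closure (vertical_line a) = {pt_ell}"
proof
  have ell0: "vector [0, 0, 1] \<noteq> (0 :: complex ^ 3)"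
    by (simp add: vector3_nonzero)
  show "line_at_infinity \<inter> closure (vertical_line a) \<subseteq> {pt_ell}"
  proof
    fix x
    assume x: "x \<in> line_at_infinity \<inter> closure (vertical_line a)"
    define Q :: "3 cproj set" where "Q = {cproj_of v | v. v \<noteq> 0 \<and> v $ 2 = a * v $ 1}"
    have Q_iff: "cproj_of v \<in> Q \<longleftrightarrow> v $ 2 = a * v $ 1" if v: "v \<noteq> 0" for v
    proof
      assume "cproj_of v \<in> Q"
      then obtain u where u: "cproj_of v = cproj_of u" "u \<noteq> 0" "u $ 2 = a * u $ 1"
        unfolding Q_def by blast
      then obtain c where "c \<noteq> 0" "u = c *s v"
        using cproj_of_eq_iff[OF v u(2)] by blast
      then show "v $ 2 = a * v $ 1"
        using u(3) by auto
    qed (use v in \<open>auto simp: Q_def\<close>)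
    have "{v. v \<noteq> 0 \<and> cproj_of v \<in> - Q} = - {0} \<inter> - {v. v $ 2 = a * v $ 1}"
      by (auto simp: Q_iff)
    moreover have "closed {v :: complex ^ 3. v $ 2 = a * v $ 1}"
      by (intro closed_Collect_eq continuous_intros)
    ultimately have "open (- Q)"
      unfolding open_cproj_def by (simp add: open_Compl open_Int)
    then have "closed Q"
      by (simp add: closed_def)
    moreover have "vertical_line a \<subseteq> Q"
      unfolding vertical_line_def
    proof clarify
      fix w
      show "affine_pt a w \<in> Q"
        unfolding affine_pt_def Q_def
        by (intro CollectI exI[of _ "vector [1, a, w]"]) (simp add: vector3_nonzero)
    qed
    ultimately have "x \<in> Q"
      using x closure_minimal by blast
    then obtain v where v: "x = cproj_of v" "v \<noteq> 0" "v $ 2 = a * v $ 1"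
      unfolding Q_def by blast
    moreover have v1: "v $ 1 = 0"
      using x v cproj_of_in_line_at_infinity_iff by auto
    ultimately have "v = (v $ 3) *s vector [0, 0, 1]" "v $ 3 \<noteq> 0"
      by (auto simp: vec_eq_iff forall_3)
    then show "x \<in> {pt_ell}"
      using cproj_of_eq_iff[OF ell0 v(2)] v(1) by (auto simp: pt_ell_def)
  qed
  have "pt_ell \<in> closure (vertical_line a)"
    unfolding closure_iff_nhds_not_empty
  proof (intro allI impI)
    fix A V :: "3 cproj set"
    assume V: "V \<subseteq> A" "open V" "pt_ell \<in> V"
    let ?f = "\<lambda>n. vector [of_real (inverse (real (Suc n))), a * of_real (inverse (real (Suc n))), 1]
        :: complex ^ 3"
    have lim0: "(\<lambda>n. of_real (inverse (real (Suc n))) :: complex) \<longlonglongrightarrow> 0"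
      using tendsto_of_real[OF LIMSEQ_inverse_real_of_nat, where 'a = complex]
      unfolding of_real_0 .
    have "\<forall>i. (\<lambda>n. ?f n $ i) \<longlonglongrightarrow> (vector [0, 0, 1] :: complex ^ 3) $ i"
      unfolding forall_3 using lim0 tendsto_mult_right_zero[OF lim0, of a]
      by (simp del: of_nat_Suc of_real_inverse)
    then have "?f \<longlonglongrightarrow> vector [0, 0, 1]"
      by (intro vec_tendstoI) blast
    moreover have "open {v. v \<noteq> 0 \<and> cproj_of v \<in> V}"
      using V(2) by (simp add: open_cproj_def)
    moreover have "vector [0, 0, 1] \<in> {v. v \<noteq> 0 \<and> cproj_of v \<in> V}"
      using V(3) ell0 by (simp add: pt_ell_def)
    ultimately have "\<forall>\<^sub>F n in sequentially. ?f n \<in> {v. v \<noteq> 0 \<and> cproj_of v \<in> V}"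
      by (rule topological_tendstoD)
    then obtain n where n: "?f n \<noteq> 0" "cproj_of (?f n) \<in> V"
      by (auto simp: eventually_sequentially)
    have "cproj_of (?f n) = affine_pt a (of_real (real (Suc n)))"
      by (subst cproj_of_eq_affine_pt_iff[OF n(1)]) (auto simp del: of_nat_Suc)
    then have "cproj_of (?f n) \<in> vertical_line a"
      by (auto simp: vertical_line_def)
    then show "vertical_line a \<inter> A \<noteq> {}"
      using n V(1) by blast
  qed
  moreover have "pt_ell \<in> line_at_infinity"
    using cproj_of_in_line_at_infinity_iff[OF ell0] by (simp add: pt_ell_def)
  ultimately show "{pt_ell} \<subseteq> line_at_infinity \<inter> closure (vertical_line a)"
    by simp
qed

section \<open>The curve\<close>

definition pole :: "(nat \<Rightarrow> real) \<Rightarrow> nat \<Rightarrow> real" where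
  "pole eps j = 1 - eps j"

definition omega :: "(nat \<Rightarrow> real) \<Rightarrow> (nat \<Rightarrow> real) \<Rightarrow> complex \<Rightarrow> complex" where
  "omega eps c \<zeta> =
     (\<Sum>j. of_real (c j) / (\<zeta> - of_real (pole eps j))) + (\<Sum>j. of_real (c j / pole eps j))"

definition gamma0 :: "(nat \<Rightarrow> real) \<Rightarrow> (nat \<Rightarrow> real) \<Rightarrow> 3 cproj set" where
  "gamma0 eps c = {affine_pt \<zeta> (omega eps c \<zeta>) | \<zeta>. cmod \<zeta> = 1}"

definition graph_omega :: "(nat \<Rightarrow> real) \<Rightarrow> (nat \<Rightarrow> real) \<Rightarrow> 3 cproj set" where
  "graph_omega eps c =
     {affine_pt \<zeta> (omega eps c \<zeta>) | \<zeta>. \<zeta> \<notin> {1} \<union> range (\<lambda>j. of_real (pole eps j))}"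

definition curve_W :: "(nat \<Rightarrow> real) \<Rightarrow> (nat \<Rightarrow> real) \<Rightarrow> 3 cproj set" where
  "curve_W eps c = top_of_set (- line_L) closure_of graph_omega eps c"

definition pt_p :: "(nat \<Rightarrow> real) \<Rightarrow> (nat \<Rightarrow> real) \<Rightarrow> 3 cproj" where
  "pt_p eps c = affine_pt 1 (omega eps c 1)"

end

theory Submission
  imports Defs "HOL-Complex_Analysis.Conformal_Mappings"
begin

text \<open>
  Write \<open>\<omega>\<^sub>N\<close> for the sum of the first \<open>N\<close> terms of \<open>\<omega>\<close>.  On the unit circle each pole \<open>a\<^sub>j\<close> has
  distance at least \<open>\<epsilon>\<^sub>j\<close>, so \<open>\<omega>\<^sub>N\<close> converges to \<open>\<omega>\<close> uniformly there, and both inclusions for the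
  hull compare \<open>\<omega>\<close> with the rational functions \<open>\<omega>\<^sub>N\<close>.

  The hull is large because of analytic discs.  The map
  \<open>z \<mapsto> B\<^sub>N(z) (1, z, \<omega>\<^sub>N(z))\<close>, with \<open>B\<^sub>N\<close> the Blaschke product of the first \<open>N\<close> poles, has no poles
  and no zeros on the closed unit disc, and on the circle it represents points close to the curve.
  The maximum principle bounds every section of degree \<open>d\<close> along this disc by its values near the
  curve; dividing by \<open>B\<^sub>N(z)\<^sup>d\<close> costs a factor \<open>\<beta>\<^sup>-\<^sup>d\<close>, where \<open>\<beta> > 0\<close> is a lower bound for
  \<open>|B\<^sub>N(z)|\<close>.  Such a bound, uniform in \<open>N\<close>, exists because \<open>\<Sum>\<epsilon>\<^sub>j\<close> converges.  At the point \<open>z = a\<^sub>0\<close>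
  the disc passes through \<open>\<ell>\<close>.  The discs \<open>t \<mapsto> (t, 1, t \<omega>\<^sub>N(1/t))\<close> reach the part of the graph
  outside the unit disc, the point \<open>p\<close>, and the point of \<open>W\<close> at infinity.  The lemmas are
  \<open>hull_by_discs\<close>, \<open>blaschke_bounded_below\<close> and \<open>curve_W_subset_hull\<close>.

  The hull is small if \<open>c\<^sub>j\<close> decreases fast.  Clearing denominators in \<open>w - \<omega>\<^sub>N(z)\<close> gives a section
  of degree \<open>N + 1\<close> whose size on the curve is at most \<open>2\<^sup>N\<close> times the tail of the series.  With
  \<open>\<epsilon>\<^sub>j\<close> dyadic and the tail at most \<open>2 (1/2)^(N\<^sup>3)\<close> this is smaller than \<open>\<delta>^(N\<^sup>2)\<close> for every \<open>\<delta> > 0\<close> and large \<open>N\<close>,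
  even after division by the \<open>N\<close>-th power of a constant.  At a point outside \<open>W \<union> {\<ell>, p}\<close> the value
  of the section is bounded below by a multiple of \<open>\<delta>^(N\<^sup>2)\<close> for a suitable \<open>\<delta>\<close>, so the point is not
  in the hull (\<open>not_in_hull\<close>, \<open>hull_affine\<close>,
  \<open>hull_at_infinity\<close>).

  The closure contains \<open>L\<close> because \<open>\<omega>\<close> takes values near any prescribed \<open>w\<close> close to the poles:
  near \<open>a\<^sub>j\<close> the function \<open>\<omega>\<close> is \<open>c\<^sub>j / (\<zeta> - a\<^sub>j)\<close> plus a remainder that tends to \<open>\<omega>(1)\<close>, and
  solving \<open>c\<^sub>j / (\<zeta> - a\<^sub>j) = w - \<omega>(1)\<close> gives a point much closer to \<open>a\<^sub>j\<close> than to any other pole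
  (\<open>line_point_in_closure_graph\<close>).
\<close>

section \<open>Topology of complex projective space\<close>

lemma cproj_of_scale:
  assumes "v \<noteq> 0" "c \<noteq> 0"
  shows "cproj_of (c *s v) = cproj_of v"
proof -
  have "c *s v \<noteq> 0"
    using assms by (simp add: vec_eq_iff)
  then show ?thesis
    using assms cproj_of_eq_iff[of v "c *s v"] by auto
qed

lemma cproj_cases [case_names cproj_of]:
  obtains v where "v \<noteq> 0" "x = cproj_of v"
  using cproj_of_rep cproj_rep_nonzero by metis

text \<open>
  The projection from the punctured space is continuous, so closure points can be found by
  taking limits of representatives.
\<close>

lemma cproj_of_in_closure:
  assumes lim: "u \<longlonglongrightarrow> v" and u: "\<And>n. u n \<noteq> 0" "\<And>n. cproj_of (u n) \<in> A" and v: "v \<noteq> 0"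
  shows "cproj_of v \<in> closure A"
  unfolding closure_iff_nhds_not_empty
proof (intro allI impI)
  fix B V
  assume V: "V \<subseteq> B" "open V" "cproj_of v \<in> V"
  have "open {x. x \<noteq> 0 \<and> cproj_of x \<in> V}"
    using V(2) by (simp add: open_cproj_def)
  moreover have "v \<in> {x. x \<noteq> 0 \<and> cproj_of x \<in> V}"
    using V(3) v by simp
  ultimately have "\<forall>\<^sub>F n in sequentially. u n \<in> {x. x \<noteq> 0 \<and> cproj_of x \<in> V}"
    using lim by (intro topological_tendstoD)
  then obtain n where "cproj_of (u n) \<in> V"
    by (auto simp: eventually_sequentially)
  then show "A \<inter> B \<noteq> {}"
    using u V(1) by blast
qed

text \<open>
  The saturation of an open set of representatives is a union of its dilates.
\<close>

lemma open_cproj_of_image: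
  assumes S: "open S" "0 \<notin> S"
  shows "open (cproj_of ` S)"
proof -
  have "{v. v \<noteq> 0 \<and> cproj_of v \<in> cproj_of ` S} = (\<Union>c\<in>-{0}. (\<lambda>v. c *s v) -` S)"
  proof (intro set_eqI iffI)
    fix v assume "v \<in> {v. v \<noteq> 0 \<and> cproj_of v \<in> cproj_of ` S}"
    then obtain s where "v \<noteq> 0" "s \<in> S" "cproj_of v = cproj_of s"
      by blast
    moreover from this have "s \<noteq> 0"
      using S(2) by blast
    ultimately show "v \<in> (\<Union>c\<in>-{0}. (\<lambda>v. c *s v) -` S)"
      using cproj_of_eq_iff[of v s] by auto
  next
    fix v assume "v \<in> (\<Union>c\<in>-{0}. (\<lambda>v. c *s v) -` S)"
    then obtain c where c: "c \<noteq> 0" "c *s v \<in> S"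
      by blast
    moreover have "c *s 0 = (0 :: complex ^ 'a)"
      by (simp add: vec_eq_iff)
    then have "v \<noteq> 0"
      using c(2) S(2) by auto
    moreover have "cproj_of v = cproj_of (c *s v)"
      using cproj_of_scale[OF \<open>v \<noteq> 0\<close> c(1)] by simp
    ultimately show "v \<in> {v. v \<noteq> 0 \<and> cproj_of v \<in> cproj_of ` S}"
      by blast
  qed
  moreover have "open ((\<lambda>v. c *s v) -` S)" for c :: complex
  proof (rule open_vimage[OF S(1)])
    show "continuous_on UNIV (\<lambda>v. c *s v :: complex ^ 'a)"
      unfolding vector_scalar_mult_def by (intro continuous_intros)
  qed
  ultimately show ?thesis
    unfolding open_cproj_def by auto
qed

text \<open>
  The representatives that violate a closed condition have an open image, so limits of points
  inherit the condition.
\<close>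

lemma closure_homogeneous_condition:
  assumes R: "closed {v. R v}" and A: "\<And>v. v \<noteq> 0 \<Longrightarrow> cproj_of v \<in> A \<Longrightarrow> R v"
    and v: "v \<noteq> 0" "cproj_of v \<in> closure A"
  shows "R v"
proof (rule ccontr)
  assume "\<not> R v"
  let ?S = "- {v. R v} \<inter> - {0}"
  have "open (cproj_of ` ?S)"
    using R by (intro open_cproj_of_image open_Int) auto
  moreover have "cproj_of v \<in> cproj_of ` ?S"
    using v \<open>\<not> R v\<close> by blast
  ultimately have "A \<inter> cproj_of ` ?S \<noteq> {}"
    using v(2) unfolding closure_iff_nhds_not_empty by blast
  then obtain u where "\<not> R u" "u \<noteq> 0" "cproj_of u \<in> A"
    by blast
  then show False
    using A by blast
qed

section \<open>The affine chart of the projective plane\<close>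

lemma tendsto_vector3:
  fixes f g h :: "'b \<Rightarrow> complex"
  assumes "(f \<longlongrightarrow> a) F" "(g \<longlongrightarrow> b) F" "(h \<longlongrightarrow> c) F"
  shows "((\<lambda>x. vector [f x, g x, h x] :: complex ^ 3) \<longlongrightarrow> vector [a, b, c]) F"
proof (rule vec_tendstoI)
  have "\<forall>i. ((\<lambda>x. (vector [f x, g x, h x] :: complex ^ 3) $ i) \<longlongrightarrow> vector [a, b, c] $ i) F"
    unfolding forall_3 using assms by simp
  then show "((\<lambda>x. (vector [f x, g x, h x] :: complex ^ 3) $ i) \<longlongrightarrow> vector [a, b, c] $ i) F" for i
    by blast
qed

lemma vector3_scale: "c *s (vector [x, y, z] :: complex ^ 3) = vector [c * x, c * y, c * z]"
  by (simp add: vec_eq_iff forall_3)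

lemma norm_vector3_le: "norm (vector [x, y, z] :: complex ^ 3) \<le> cmod x + cmod y + cmod z"
proof -
  have "norm (vector [x, y, z] :: complex ^ 3) \<le> (\<Sum>i\<in>UNIV. cmod ((vector [x, y, z] :: complex ^ 3) $ i))"
    unfolding norm_vec_def by (intro L2_set_le_sum) simp
  then show ?thesis
    by (simp add: sum_3)
qed

lemma affine_pt_vector_nz [simp]: "vector [1, z, w] \<noteq> (0 :: complex ^ 3)"
  by (simp add: vector3_nonzero)

lemma affine_pt_in_closure:
  assumes z: "(z, w) \<in> closure A"
  shows "affine_pt z w \<in> closure ((\<lambda>(z, w). affine_pt z w) ` A)"
proof -
  obtain q where q: "\<And>n. q n \<in> A" "q \<longlonglongrightarrow> (z, w)"
    using z unfolding closure_sequential by blast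
  then have "(\<lambda>n. fst (q n)) \<longlonglongrightarrow> z" "(\<lambda>n. snd (q n)) \<longlonglongrightarrow> w"
    by (auto intro: tendsto_eq_intros)
  then have "(\<lambda>n. vector [1, fst (q n), snd (q n)] :: complex ^ 3) \<longlonglongrightarrow> vector [1, z, w]"
    by (intro tendsto_vector3 tendsto_const)
  then show ?thesis
    unfolding affine_pt_def
  proof (rule cproj_of_in_closure)
    show "cproj_of (vector [1, fst (q n), snd (q n)]) \<in> (\<lambda>(z, w). cproj_of (vector [1, z, w])) ` A" for n
      using q(1)[of n] by force
  qed simp_all
qed

text \<open>
  The affine chart is open in the plane, so the closure of an affine set inside the chart can be
  computed with sequences of coordinates.
\<close>

lemma closure_affine_ptD:
  assumes x: "affine_pt z w \<in> closure ((\<lambda>(z, w). affine_pt z w) ` A)"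
  shows "(z, w) \<in> closure A"
  unfolding closure_iff_nhds_not_empty
proof (intro allI impI)
  fix B U
  assume U: "U \<subseteq> B" "open U" "(z, w) \<in> U"
  define S :: "(complex ^ 3) set" where
    "S = {v. v $ 1 \<noteq> 0} \<inter> (\<lambda>v. (v $ 2 / v $ 1, v $ 3 / v $ 1)) -` U"
  have "open {v :: complex ^ 3. v $ 1 \<noteq> 0}"
    by (intro open_Collect_neq continuous_intros)
  then have "open S"
    unfolding S_def using U(2)
    by (intro continuous_open_preimage) (auto intro!: continuous_intros)
  then have "open (cproj_of ` S)"
    by (intro open_cproj_of_image) (auto simp: S_def)
  moreover have "vector [1, z, w] \<in> S"
    using U(3) by (simp add: S_def)
  then have "affine_pt z w \<in> cproj_of ` S"
    unfolding affine_pt_def by blast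
  ultimately have "(\<lambda>(z, w). affine_pt z w) ` A \<inter> cproj_of ` S \<noteq> {}"
    using x unfolding closure_iff_nhds_not_empty by blast
  then obtain z' w' s where s: "(z', w') \<in> A" "s \<in> S" "cproj_of s = affine_pt z' w'"
    by (auto simp: eq_commute[of "affine_pt _ _"])
  moreover have "s \<noteq> 0"
    using s(2) by (auto simp: S_def)
  ultimately have "s $ 1 \<noteq> 0" "s $ 2 = z' * s $ 1" "s $ 3 = w' * s $ 1"
    using cproj_of_eq_affine_pt_iff[of s z' w'] by auto
  then have "(z', w') \<in> U"
    using s(2) by (simp add: S_def)
  then show "A \<inter> B \<noteq> {}"
    using s(1) U(1) by blast
qed

lemma line_L_iff:
  assumes "v \<noteq> 0"
  shows "cproj_of v \<in> line_L \<longleftrightarrow> v $ 2 = v $ 1"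
proof
  assume "cproj_of v \<in> line_L"
  then show "v $ 2 = v $ 1"
    unfolding line_L_def
  proof (rule closure_homogeneous_condition[OF _ _ assms, rotated 2])
    show "closed {v :: complex ^ 3. v $ 2 = v $ 1}"
      by (intro closed_Collect_eq continuous_intros)
    show "v $ 2 = v $ 1" if "v \<noteq> 0" "cproj_of v \<in> vertical_line 1" for v
      using that cproj_of_eq_affine_pt_iff[of v 1] by (auto simp: vertical_line_def)
  qed
next
  assume eq: "v $ 2 = v $ 1"
  show "cproj_of v \<in> line_L"
  proof (cases "v $ 1 = 0")
    case True
    have "vector [0, 0, 1] \<noteq> (0 :: complex ^ 3)"
      by (simp add: vector3_nonzero)
    moreover have "v = (v $ 3) *s vector [0, 0, 1]" "v $ 3 \<noteq> 0"
      using True eq assms by (auto simp: vec_eq_iff forall_3)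
    ultimately have "cproj_of v = pt_ell"
      unfolding pt_ell_def by (metis cproj_of_scale)
    then show ?thesis
      using line_at_infinity_inter_vertical_line[of 1] by (auto simp: line_L_def)
  next
    case False
    then have "cproj_of v = affine_pt 1 (v $ 3 / v $ 1)"
      using eq cproj_of_eq_affine_pt_iff[OF assms] by simp
    then show ?thesis
      unfolding line_L_def vertical_line_def by (intro closure_subset[THEN subsetD]) blast
  qed
qed

lemma affine_pt_in_line_L_iff: "affine_pt z w \<in> line_L \<longleftrightarrow> z = 1"
  using line_L_iff[OF affine_pt_vector_nz, of z w] by (simp add: affine_pt_def)

lemma pt_ell_in_line_L: "pt_ell \<in> line_L"
  using line_L_iff[of "vector [0, 0, 1]"] by (simp add: vector3_nonzero pt_ell_def)

text \<open>
  The point at infinity common to all horizontal lines.  It lies on the curve \<open>W\<close>, over \<open>\<zeta> = \<infinity>\<close>,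
  because \<open>\<omega>\<close> stays bounded there.
\<close>

definition pt_horizontal :: "3 cproj" where
  "pt_horizontal = cproj_of (vector [0, 1, 0])"

lemma pt_horizontal_nz [simp]: "vector [0, 1, 0] \<noteq> (0 :: complex ^ 3)"
  by (simp add: vector3_nonzero)

lemma plane_cases:
  fixes x :: "3 cproj"
  obtains (affine) z w where "x = affine_pt z w"
    | (ell) "x = pt_ell"
    | (infinity) w where "x = cproj_of (vector [0, 1, w])"
proof -
  obtain v where v: "v \<noteq> 0" "x = cproj_of v"
    by (rule cproj_cases)
  consider "v $ 1 \<noteq> 0" | "v $ 1 = 0" "v $ 2 = 0" | "v $ 1 = 0" "v $ 2 \<noteq> 0"
    by blast
  then show ?thesis
  proof cases
    case 1
    then have "x = affine_pt (v $ 2 / v $ 1) (v $ 3 / v $ 1)"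
      using v cproj_of_eq_affine_pt_iff[OF v(1)] by simp
    then show ?thesis by (rule affine)
  next
    case 2
    have eq: "v = v $ 3 *s vector [0, 0, 1]"
      using 2 by (auto simp: vec_eq_iff forall_3)
    have "v $ 3 \<noteq> 0"
      using v(1) 2 by (auto simp: vec_eq_iff forall_3)
    then have "cproj_of (v $ 3 *s vector [0, 0, 1]) = pt_ell"
      unfolding pt_ell_def by (intro cproj_of_scale) (auto simp: vector3_nonzero)
    then show ?thesis
      using eq v(2) ell by metis
  next
    case 3
    then have eq: "v = v $ 2 *s vector [0, 1, v $ 3 / v $ 2]"
      by (auto simp: vec_eq_iff forall_3)
    have "vector [0, 1, v $ 3 / v $ 2] \<noteq> (0 :: complex ^ 3)"
      by (simp add: vector3_nonzero)
    then have "cproj_of (v $ 2 *s vector [0, 1, v $ 3 / v $ 2]) = cproj_of (vector [0, 1, v $ 3 / v $ 2] :: complex ^ 3)"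
      using 3(2) by (rule cproj_of_scale)
    then show ?thesis
      using eq v(2) infinity by metis
  qed
qed

section \<open>Sections along analytic discs\<close>

definition cdiff_at :: "(complex ^ 'n \<Rightarrow> complex) \<Rightarrow> complex ^ 'n \<Rightarrow> bool" where
  "cdiff_at F v \<longleftrightarrow> (\<exists>F'. (F has_derivative F') (at v) \<and> (\<forall>c u. F' (c *s u) = c * F' u))"

lemma holomorphic_off_0_iff: "holomorphic_off_0 F \<longleftrightarrow> (\<forall>v. v \<noteq> 0 \<longrightarrow> cdiff_at F v)"
  by (simp add: holomorphic_off_0_def cdiff_at_def)

lemma cdiff_at_const: "cdiff_at (\<lambda>v. k) v"
  unfolding cdiff_at_def by (intro exI[of _ "\<lambda>_. 0"]) auto

lemma cdiff_at_nth: "cdiff_at (\<lambda>v. v $ i) v"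
  unfolding cdiff_at_def
  by (intro exI[of _ "\<lambda>v. v $ i"]) (auto intro: bounded_linear_imp_has_derivative bounded_linear_vec_nth)

lemma cdiff_at_add:
  assumes "cdiff_at F v" "cdiff_at G v"
  shows "cdiff_at (\<lambda>v. F v + G v) v"
proof -
  obtain F' G' where *: "(F has_derivative F') (at v)" "\<forall>c u. F' (c *s u) = c * F' u"
    "(G has_derivative G') (at v)" "\<forall>c u. G' (c *s u) = c * G' u"
    using assms unfolding cdiff_at_def by blast
  then show ?thesis
    unfolding cdiff_at_def
    by (intro exI[of _ "\<lambda>u. F' u + G' u"]) (auto intro: has_derivative_add simp: algebra_simps)
qed

lemma cdiff_at_mult:
  assumes "cdiff_at F v" "cdiff_at G v"
  shows "cdiff_at (\<lambda>v. F v * G v) v"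
proof -
  obtain F' G' where *: "(F has_derivative F') (at v)" "\<forall>c u. F' (c *s u) = c * F' u"
    "(G has_derivative G') (at v)" "\<forall>c u. G' (c *s u) = c * G' u"
    using assms unfolding cdiff_at_def by blast
  then show ?thesis
    unfolding cdiff_at_def
    by (intro exI[of _ "\<lambda>u. F v * G' u + F' u * G v"]) (auto intro: has_derivative_mult simp: algebra_simps)
qed

lemma cdiff_at_diff:
  assumes "cdiff_at F v" "cdiff_at G v"
  shows "cdiff_at (\<lambda>v. F v - G v) v"
  using cdiff_at_add[OF assms(1) cdiff_at_mult[OF cdiff_at_const[of "-1"] assms(2)]] by simp

lemma cdiff_at_sum:
  assumes "\<And>i. i \<in> I \<Longrightarrow> cdiff_at (F i) v"
  shows "cdiff_at (\<lambda>v. \<Sum>i\<in>I. F i v) v"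
  using assms
  by (induction I rule: infinite_finite_induct) (auto intro: cdiff_at_const cdiff_at_add)

lemma cdiff_at_prod:
  assumes "\<And>i. i \<in> I \<Longrightarrow> cdiff_at (F i) v"
  shows "cdiff_at (\<lambda>v. \<Prod>i\<in>I. F i v) v"
  using assms
  by (induction I rule: infinite_finite_induct) (auto intro: cdiff_at_const cdiff_at_mult)

lemma cdiff_at_power:
  assumes "cdiff_at F v"
  shows "cdiff_at (\<lambda>v. F v ^ k) v"
  using assms by (induction k) (auto intro: cdiff_at_const cdiff_at_mult)

lemmas cdiff_at_intros = cdiff_at_const cdiff_at_nth cdiff_at_add cdiff_at_mult cdiff_at_diff
  cdiff_at_sum cdiff_at_prod cdiff_at_power

lemma section_continuous:
  assumes "F \<in> sections_O d" "v \<noteq> 0"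
  shows "isCont F v"
  using assms unfolding sections_O_def holomorphic_off_0_def
  by (auto intro: has_derivative_continuous)

lemma section_scale:
  assumes "F \<in> sections_O d" "v \<noteq> 0" "c \<noteq> 0"
  shows "F (c *s v) = c ^ d * F v"
  using assms by (auto simp: sections_O_def)

lemma field_differentiable_section_disc:
  fixes F :: "complex ^ 3 \<Rightarrow> complex"
  assumes F: "F \<in> sections_O d"
    and fgh: "f field_differentiable at z" "g field_differentiable at z" "h field_differentiable at z"
    and nz: "vector [f z, g z, h z] \<noteq> (0 :: complex ^ 3)"
  shows "(\<lambda>z. F (vector [f z, g z, h z])) field_differentiable at z"
proof -
  let ?v = "\<lambda>z. vector [f z, g z, h z] :: complex ^ 3"
  obtain f' g' h' where der: "(f has_field_derivative f') (at z)" "(g has_field_derivative g') (at z)"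
    "(h has_field_derivative h') (at z)"
    using fgh unfolding field_differentiable_def by blast
  let ?v' = "vector [f', g', h'] :: complex ^ 3"
  obtain F' where F': "(F has_derivative F') (at (?v z))" "\<And>c u. F' (c *s u) = c * F' u"
    using F nz unfolding sections_O_def holomorphic_off_0_def by blast
  have bl: "bounded_linear (\<lambda>t. t *s u)" for u :: "complex ^ 3"
    by (rule bounded_linear_intro[where K = "norm u"])
      (auto simp: norm_vector_scalar_mult vec_eq_iff algebra_simps)
  have v: "?v = (\<lambda>z. f z *s vector [1, 0, 0] + g z *s vector [0, 1, 0] + h z *s vector [0, 0, 1])"
    by (intro ext) (simp add: vec_eq_iff forall_3)
  have "((\<lambda>z. f z *s vector [1, 0, 0] + g z *s vector [0, 1, 0] + h z *s vector [0, 0, 1] :: complex ^ 3) has_derivative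
      (\<lambda>t. (f' * t) *s vector [1, 0, 0] + (g' * t) *s vector [0, 1, 0] + (h' * t) *s vector [0, 0, 1]))
      (at z)"
    using der unfolding has_field_derivative_def
    by (intro has_derivative_add bounded_linear.has_derivative[OF bl])
  moreover have "(\<lambda>t. (f' * t) *s vector [1, 0, 0] + (g' * t) *s vector [0, 1, 0] + (h' * t) *s vector [0, 0, 1] :: complex ^ 3)
      = (\<lambda>t. t *s ?v')"
    by (intro ext) (simp add: vec_eq_iff forall_3)
  ultimately have "(?v has_derivative (\<lambda>t. t *s ?v')) (at z)"
    unfolding v by simp
  then have "((\<lambda>z. F (?v z)) has_derivative (\<lambda>t. F' (t *s ?v'))) (at z)"
    using F'(1) by (rule has_derivative_compose)
  moreover have "(\<lambda>t. F' (t *s ?v')) = (*) (F' ?v')"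
    by (simp add: fun_eq_iff F'(2))
  ultimately show ?thesis
    unfolding field_differentiable_def has_field_derivative_def by auto
qed

text \<open>
  A section is not a function on the plane, but along a lift of an analytic disc to the punctured
  space it is an ordinary holomorphic function.
\<close>

lemma section_maximum_principle:
  fixes F :: "complex ^ 3 \<Rightarrow> complex"
  assumes F: "F \<in> sections_O d"
    and fgh: "\<And>z. cmod z \<le> 1 \<Longrightarrow> f field_differentiable at z"
      "\<And>z. cmod z \<le> 1 \<Longrightarrow> g field_differentiable at z"
      "\<And>z. cmod z \<le> 1 \<Longrightarrow> h field_differentiable at z"
    and nz: "\<And>z. cmod z \<le> 1 \<Longrightarrow> vector [f z, g z, h z] \<noteq> (0 :: complex ^ 3)"
    and bdry: "\<And>z. cmod z = 1 \<Longrightarrow> cmod (F (vector [f z, g z, h z])) \<le> B"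
    and z: "cmod z \<le> 1"
  shows "cmod (F (vector [f z, g z, h z])) \<le> B"
proof -
  let ?\<phi> = "\<lambda>z. F (vector [f z, g z, h z])"
  have "?\<phi> field_differentiable at z" if "cmod z \<le> 1" for z
    using that by (intro field_differentiable_section_disc[OF F] fgh nz)
  then have hol: "?\<phi> holomorphic_on cball 0 1"
    by (auto simp: holomorphic_on_def intro: field_differentiable_at_within)
  show ?thesis
  proof (rule maximum_modulus_frontier[of ?\<phi> "cball 0 1"])
    show "?\<phi> holomorphic_on interior (cball 0 1)"
      using hol by (rule holomorphic_on_subset) (rule interior_subset)
    show "continuous_on (closure (cball 0 1)) ?\<phi>"
      using hol by (auto intro: holomorphic_on_imp_continuous_on)
  qed (use bdry z in \<open>auto simp: dist_norm\<close>)
qed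

section \<open>The curve and its partial sums\<close>

text \<open>
  Used wherever a bound has to be uniform in the pole or in the number of poles: distances to
  the poles, the poles themselves, and partial Blaschke products.
\<close>

lemma tendsto_positive_bounded_below:
  fixes X :: "nat \<Rightarrow> real"
  assumes X: "X \<longlonglongrightarrow> L" "L > 0" "\<And>n. X n > 0"
  obtains \<delta> where "\<delta> > 0" "\<delta> \<le> 1" "\<And>n. \<delta> \<le> X n"
proof -
  have "Bseq (\<lambda>n. inverse (X n))"
    using X by (intro convergent_imp_Bseq convergentI[of _ "inverse L"] tendsto_inverse) auto
  then obtain K where K: "K > 0" "\<And>n. norm (inverse (X n)) \<le> K"
    by (elim BseqE) blast
  show ?thesis
  proof
    show "min 1 (inverse K) \<le> X n" for n
      using K(2)[of n] K(1) X(3)[of n] by (simp add: min_le_iff_disj field_simps)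
  qed (use K in auto)
qed

text \<open>
  The exponent \<open>N\<^sup>2\<close> absorbs the sum of the exponents \<open>j + 1\<close> over \<open>j < N\<close>.  It is the order to which
  a product of \<open>N\<close> distances to dyadically accumulating poles can be small.
\<close>

lemma prod_geometric_lower_bound:
  assumes A: "A \<subseteq> {..<N}" and \<eta>: "0 < \<eta>" "\<eta> \<le> 1"
    and x: "\<And>j. j \<in> A \<Longrightarrow> \<eta> ^ Suc j \<le> x j"
  shows "\<eta> ^ N\<^sup>2 \<le> (\<Prod>j\<in>A. x j :: real)"
proof -
  have fin: "finite A"
    using A finite_subset by blast
  have "(\<Sum>j\<in>A. Suc j) \<le> card A * N"
    using A by (intro sum_bounded_above[where 'a = nat, simplified]) auto
  also have "\<dots> \<le> N\<^sup>2"
    using card_mono[OF _ A] by (simp add: power2_eq_square)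
  finally have "\<eta> ^ N\<^sup>2 \<le> \<eta> ^ (\<Sum>j\<in>A. Suc j)"
    using \<eta> by (intro power_decreasing) auto
  also have "\<dots> = (\<Prod>j\<in>A. \<eta> ^ Suc j)"
    by (rule power_sum)
  also have "\<dots> \<le> (\<Prod>j\<in>A. x j)"
    using x \<eta> by (intro prod_mono) auto
  finally show ?thesis .
qed

locale pole_curve =
  fixes eps c :: "nat \<Rightarrow> real"
  assumes eps_pos: "0 < eps j" and eps_lt_1: "eps j < 1" and inj_eps: "inj eps"
    and c_pos: "0 < c j"
    and summable_eps: "summable eps" and summable_c_eps: "summable (\<lambda>j. c j / eps j)"
begin

abbreviation a :: "nat \<Rightarrow> complex" where
  "a j \<equiv> of_real (pole eps j)"

definition omega_part :: "nat \<Rightarrow> complex \<Rightarrow> complex" where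
  "omega_part N \<zeta> = (\<Sum>j<N. of_real (c j) / (\<zeta> - a j)) + (\<Sum>j<N. of_real (c j / pole eps j))"

text \<open>
  A bound, valid for \<open>|\<zeta>| \<ge> 1\<close>, for the distance of \<open>\<omega>(\<zeta>)\<close> from its partial sums.
\<close>

definition tail :: "nat \<Rightarrow> real" where
  "tail N = (\<Sum>j. c (j + N) / eps (j + N) + c (j + N) / pole eps (j + N))"

lemma pole_pos: "0 < pole eps j"
  using eps_lt_1[of j] by (simp add: pole_def)

lemma pole_lt_1: "pole eps j < 1"
  using eps_pos[of j] by (simp add: pole_def)

lemma norm_a: "cmod (a j) = pole eps j"
  using pole_pos[of j] by simp

lemma a_eq_iff: "a i = a j \<longleftrightarrow> i = j"
  using inj_eps by (auto simp: pole_def inj_def)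

lemma a_ne_1: "a j \<noteq> 1"
  using pole_lt_1[of j] by (metis less_irrefl of_real_eq_1_iff)

lemma norm_1_minus_a: "cmod (1 - a j) = eps j"
proof -
  have "1 - a j = of_real (eps j)"
    by (simp add: pole_def)
  then show ?thesis
    using eps_pos[of j] by simp
qed

lemma eps_tendsto_0: "eps \<longlonglongrightarrow> 0"
  by (rule summable_LIMSEQ_zero[OF summable_eps])

lemma pole_tendsto_1: "pole eps \<longlonglongrightarrow> 1"
  using tendsto_diff[OF tendsto_const eps_tendsto_0, of 1] by (simp add: pole_def[abs_def])

lemma a_tendsto_1: "a \<longlonglongrightarrow> 1"
  using tendsto_of_real[OF pole_tendsto_1, where 'a = complex] by simp

lemma summable_c: "summable c"
proof (rule summable_comparison_test'[OF summable_c_eps])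
  show "norm (c j) \<le> c j / eps j" for j
    using c_pos[of j] eps_pos[of j] eps_lt_1[of j] by (simp add: field_simps)
qed

lemma summable_c_pole: "summable (\<lambda>j. c j / pole eps j)"
proof -
  obtain \<alpha> where \<alpha>: "\<alpha> > 0" "\<And>j. \<alpha> \<le> pole eps j"
    using tendsto_positive_bounded_below[OF pole_tendsto_1] pole_pos by (metis zero_less_one)
  show ?thesis
  proof (rule summable_comparison_test'[OF summable_mult[OF summable_c, of "1 / \<alpha>"]])
    show "norm (c j / pole eps j) \<le> 1 / \<alpha> * c j" for j
      using c_pos[of j] pole_pos[of j] \<alpha> by (simp add: frac_le)
  qed
qed

text \<open>
  The poles accumulate only at \<open>1\<close>.
\<close>

lemma pole_distance_away:
  assumes "z \<noteq> 1"
  obtains \<delta> where "\<delta> > 0" "\<delta> \<le> 1" "\<And>j. z \<noteq> a j \<Longrightarrow> \<delta> \<le> cmod (z - a j)"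
proof -
  let ?X = "\<lambda>j. if z = a j then 1 else cmod (z - a j)"
  have "\<forall>\<^sub>F j in sequentially. a j \<noteq> z"
    using tendsto_imp_eventually_ne[OF a_tendsto_1, of z] assms by auto
  then have "\<forall>\<^sub>F j in sequentially. cmod (z - a j) = ?X j"
    by eventually_elim auto
  moreover have "(\<lambda>j. cmod (z - a j)) \<longlonglongrightarrow> cmod (z - 1)"
    by (intro tendsto_intros a_tendsto_1)
  ultimately have "?X \<longlonglongrightarrow> cmod (z - 1)"
    by (rule Lim_transform_eventually[rotated])
  then obtain \<delta> where \<delta>: "\<delta> > 0" "\<delta> \<le> 1" "\<And>j. \<delta> \<le> ?X j"
    by (rule tendsto_positive_bounded_below) (use assms in auto)
  show ?thesis
  proof
    show "\<delta> \<le> cmod (z - a j)" if "z \<noteq> a j" for j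
      using \<delta>(3)[of j] that by simp
  qed (use \<delta> in auto)
qed

text \<open>
  One bound for all \<open>z\<close>: at \<open>z = 1\<close> the distances to the poles are exactly \<open>\<epsilon>\<^sub>j\<close>, and elsewhere they
  stay away from \<open>0\<close>.
\<close>

lemma pole_distance:
  obtains \<delta> where "\<delta> > 0" "\<delta> \<le> 1" "\<And>j. z \<noteq> a j \<Longrightarrow> \<delta> * eps j \<le> cmod (z - a j)"
proof (cases "z = 1")
  case True
  then show ?thesis
    by (intro that[of 1]) (auto simp: norm_1_minus_a)
next
  case False
  then obtain \<delta> where \<delta>: "\<delta> > 0" "\<delta> \<le> 1" "\<And>j. z \<noteq> a j \<Longrightarrow> \<delta> \<le> cmod (z - a j)"
    using pole_distance_away by blast
  show ?thesis
  proof
    fix j assume "z \<noteq> a j"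
    then have "\<delta> \<le> cmod (z - a j)"
      using \<delta>(3) by blast
    moreover have "\<delta> * eps j \<le> \<delta>"
      using \<delta>(1) eps_lt_1[of j] by simp
    ultimately show "\<delta> * eps j \<le> cmod (z - a j)"
      by simp
  qed (use \<delta> in auto)
qed

lemma summable_terms:
  assumes \<delta>: "\<delta> > 0" and z: "\<And>j. \<delta> * eps j \<le> cmod (z - a j)"
  shows "summable (\<lambda>j. norm (of_real (c j) / (z - a j)))"
proof (rule summable_comparison_test'[OF summable_mult[OF summable_c_eps, of "1 / \<delta>"]])
  fix j
  have "0 < \<delta> * eps j"
    using \<delta> eps_pos[of j] by simp
  then have "c j / cmod (z - a j) \<le> c j / (\<delta> * eps j)"
    using z[of j] c_pos[of j] by (intro frac_le) auto
  then show "norm (norm (of_real (c j) / (z - a j))) \<le> 1 / \<delta> * (c j / eps j)"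
    using c_pos[of j] by (simp add: norm_divide)
qed

lemma summable_terms_nonpole:
  assumes "z \<notin> range a"
  shows "summable (\<lambda>j. norm (of_real (c j) / (z - a j)))"
proof -
  obtain \<delta> where "\<delta> > 0" "\<And>j. z \<noteq> a j \<Longrightarrow> \<delta> * eps j \<le> cmod (z - a j)"
    using pole_distance by blast
  then show ?thesis
    using assms by (intro summable_terms[of \<delta>]) auto
qed

lemma summable_consts: "summable (\<lambda>j. of_real (c j / pole eps j) :: complex)"
  by (rule summable_of_real[OF summable_c_pole])

lemma omega_part_tendsto:
  assumes "z \<notin> range a"
  shows "(\<lambda>N. omega_part N z) \<longlonglongrightarrow> omega eps c z"
  unfolding omega_part_def omega_def
  by (intro tendsto_add summable_LIMSEQ summable_consts
      summable_norm_cancel[OF summable_terms_nonpole[OF assms]])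

lemma circle_distance:
  assumes "1 \<le> cmod \<zeta>"
  shows "eps j \<le> cmod (\<zeta> - a j)"
  using norm_triangle_ineq2[of \<zeta> "a j"] assms norm_a[of j] by (simp add: pole_def)

lemma outside_nonpole:
  assumes "1 \<le> cmod \<zeta>"
  shows "\<zeta> \<notin> range a"
proof
  assume "\<zeta> \<in> range a"
  then obtain j where "\<zeta> = a j"
    by blast
  then show False
    using circle_distance[OF assms, of j] eps_pos[of j] by simp
qed

lemma summable_tail: "summable (\<lambda>j. c j / eps j + c j / pole eps j)"
  by (intro summable_add summable_c_eps summable_c_pole)

lemma tail_tendsto_0: "tail \<longlonglongrightarrow> 0"
proof -
  let ?f = "\<lambda>j. c j / eps j + c j / pole eps j"
  have "tail = (\<lambda>N. suminf ?f - (\<Sum>j<N. ?f j))"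
    unfolding tail_def[abs_def] using suminf_minus_initial_segment[OF summable_tail] by simp
  moreover have "(\<lambda>N. suminf ?f - (\<Sum>j<N. ?f j)) \<longlonglongrightarrow> suminf ?f - suminf ?f"
    by (intro tendsto_diff tendsto_const summable_LIMSEQ summable_tail)
  ultimately show ?thesis
    by simp
qed

lemma omega_minus_part_le_tail:
  assumes \<zeta>: "1 \<le> cmod \<zeta>"
  shows "cmod (omega eps c \<zeta> - omega_part N \<zeta>) \<le> tail N"
proof -
  let ?f = "\<lambda>j. of_real (c j) / (\<zeta> - a j)" and ?g = "\<lambda>j. of_real (c j / pole eps j) :: complex"
  have sf: "summable ?f"
    by (rule summable_norm_cancel[OF summable_terms_nonpole[OF outside_nonpole[OF \<zeta>]]])
  have s: "summable (\<lambda>j. ?f (j + N) + ?g (j + N))"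
    using summable_ignore_initial_segment[OF summable_add[OF sf summable_consts], of N] .
  have "omega eps c \<zeta> - omega_part N \<zeta> = (\<Sum>j. ?f (j + N)) + (\<Sum>j. ?g (j + N))"
    unfolding omega_def omega_part_def
    using suminf_minus_initial_segment[OF sf, of N] suminf_minus_initial_segment[OF summable_consts, of N]
    by (simp add: algebra_simps)
  also have "\<dots> = (\<Sum>j. ?f (j + N) + ?g (j + N))"
    by (intro suminf_add summable_ignore_initial_segment sf summable_consts)
  also have "cmod \<dots> \<le> tail N"
    unfolding tail_def
  proof (rule norm_suminf_le)
    show "summable (\<lambda>j. c (j + N) / eps (j + N) + c (j + N) / pole eps (j + N))"
      by (rule summable_ignore_initial_segment[OF summable_tail])
    fix j
    have "cmod (?f i) \<le> c i / eps i" for i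
      using circle_distance[OF \<zeta>, of i] eps_pos[of i] c_pos[of i]
      by (simp add: norm_divide frac_le)
    moreover have "cmod (?g i) \<le> c i / pole eps i" for i
      using c_pos[of i] pole_pos[of i] by (simp add: norm_divide)
    ultimately show "cmod (?f (j + N) + ?g (j + N)) \<le> c (j + N) / eps (j + N) + c (j + N) / pole eps (j + N)"
      by (intro norm_triangle_mono)
  qed
  finally show ?thesis .
qed

lemma omega_bound:
  assumes "1 \<le> cmod \<zeta>"
  shows "cmod (omega eps c \<zeta>) \<le> tail 0"
  using omega_minus_part_le_tail[OF assms, of 0] by (simp add: omega_part_def)

lemma tail_nonneg: "0 \<le> tail N"
  using order_trans[OF norm_ge_zero omega_minus_part_le_tail[of 1 N]] by simp

section \<open>Analytic discs attached to the curve\<close>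

text \<open>
  Compact sets of representatives in the affine chart.  They avoid the origin, so sections are
  bounded and uniformly continuous on them.
\<close>

definition chart_ball :: "real \<Rightarrow> (complex ^ 3) set" where
  "chart_ball M = {v. v $ 1 = 1} \<inter> cball 0 M"

lemma compact_chart_ball: "compact (chart_ball M)"
  unfolding chart_ball_def by (intro closed_Int_compact closed_Collect_eq continuous_intros) auto

lemma zero_notin_chart_ball: "0 \<notin> chart_ball M"
  by (simp add: chart_ball_def)

lemma section_continuous_on_chart_ball:
  assumes "F \<in> sections_O d"
  shows "continuous_on (chart_ball M) F"
proof (rule continuous_at_imp_continuous_on, rule ballI)
  fix v assume "v \<in> chart_ball M"
  then have "v \<noteq> 0"
    using zero_notin_chart_ball by blast
  then show "isCont F v"
    by (rule section_continuous[OF assms])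
qed

lemma curve_in_chart_ball:
  assumes "cmod \<zeta> = 1" "cmod w \<le> tail 0 + 1"
  shows "vector [1, \<zeta>, w] \<in> chart_ball (tail 0 + 3)"
  using norm_vector3_le[of 1 \<zeta> w] assms by (simp add: chart_ball_def)

lemma norm_affine_ge_1: "1 \<le> norm (vector [1, z, w] :: complex ^ 3)"
  using Finite_Cartesian_Product.norm_nth_le[of "vector [1, z, w] :: complex ^ 3" 1] by simp

lemma section_norm_affine_le:
  assumes "F \<in> sections_O d"
  shows "section_norm d F (affine_pt z w) \<le> cmod (F (vector [1, z, w]))"
proof -
  have "cmod (F (vector [1, z, w])) / norm (vector [1, z, w] :: complex ^ 3) ^ d
      \<le> cmod (F (vector [1, z, w])) / 1"
    by (intro divide_left_mono one_le_power norm_affine_ge_1) auto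
  then show ?thesis
    unfolding affine_pt_def section_norm_cproj_of[OF assms affine_pt_vector_nz] by simp
qed

lemma gamma0_eq: "gamma0 eps c = (\<lambda>\<zeta>. affine_pt \<zeta> (omega eps c \<zeta>)) ` {\<zeta>. cmod \<zeta> = 1}"
  by (auto simp: gamma0_def)

lemma bdd_above_section_norm:
  assumes F: "F \<in> sections_O d"
  shows "bdd_above (section_norm d F ` gamma0 eps c)"
proof -
  have "bounded (F ` chart_ball (tail 0 + 3))"
    by (intro compact_imp_bounded compact_continuous_image section_continuous_on_chart_ball[OF F]
        compact_chart_ball)
  then obtain B where B: "\<And>v. v \<in> chart_ball (tail 0 + 3) \<Longrightarrow> cmod (F v) \<le> B"
    by (auto simp: bounded_iff)
  show ?thesis
  proof (rule bdd_aboveI2)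
    fix y assume "y \<in> gamma0 eps c"
    then obtain \<zeta> where "cmod \<zeta> = 1" "y = affine_pt \<zeta> (omega eps c \<zeta>)"
      by (auto simp: gamma0_eq)
    then show "section_norm d F y \<le> B"
      using section_norm_affine_le[OF F, of \<zeta> "omega eps c \<zeta>"]
        B[OF curve_in_chart_ball, of \<zeta> "omega eps c \<zeta>"] omega_bound[of \<zeta>] by simp
  qed
qed

text \<open>
  The representatives \<open>(1, \<zeta>, \<omega>(\<zeta>))\<close> have bounded norm, so passing from the Fubini--Study norm to
  the value on the representative costs only a factor that is geometric in the degree.
\<close>

lemma section_on_curve_le:
  assumes F: "F \<in> sections_O d" and \<zeta>: "cmod \<zeta> = 1"
  shows "cmod (F (vector [1, \<zeta>, omega eps c \<zeta>]))
    \<le> (tail 0 + 3) ^ d * (SUP y\<in>gamma0 eps c. section_norm d F y)"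
proof -
  let ?v = "vector [1, \<zeta>, omega eps c \<zeta>] :: complex ^ 3"
  let ?S = "SUP y\<in>gamma0 eps c. section_norm d F y"
  have "section_norm d F (affine_pt \<zeta> (omega eps c \<zeta>)) \<le> ?S"
    using \<zeta> by (intro cSUP_upper bdd_above_section_norm[OF F]) (auto simp: gamma0_eq)
  then have le: "cmod (F ?v) / norm ?v ^ d \<le> ?S"
    unfolding affine_pt_def section_norm_cproj_of[OF F affine_pt_vector_nz] .
  then have "0 \<le> ?S"
    by (meson divide_nonneg_nonneg norm_ge_zero order_trans zero_le_power)
  have pos: "0 < norm ?v ^ d"
    by (intro zero_less_power) simp
  have "norm ?v \<le> tail 0 + 3"
    using curve_in_chart_ball[OF \<zeta>, of "omega eps c \<zeta>"] omega_bound[of \<zeta>] \<zeta>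
    by (simp add: chart_ball_def)
  then have "norm ?v ^ d \<le> (tail 0 + 3) ^ d"
    by (intro power_mono) auto
  then have "?S * norm ?v ^ d \<le> (tail 0 + 3) ^ d * ?S"
    using \<open>0 \<le> ?S\<close> by (simp add: mult.commute mult_left_mono)
  then show ?thesis
    using le pos by (simp add: pos_divide_le_eq)
qed

text \<open>
  The source of all points of the hull.  The discs \<open>(f\<^sub>N, g\<^sub>N, h\<^sub>N)\<close> have boundary on the curve of
  the partial sum \<open>\<omega>\<^sub>N\<close>, which converges uniformly to the given curve; a uniform lower bound for
  the scaling factors \<open>l\<^sub>N\<close> at the point of interest turns into the constant of the hull.
  The index \<open>N = 0\<close> is left out of the conditions at \<open>z0\<close>, since a disc through \<open>\<ell>\<close> exists only
  once there is a pole.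
\<close>

lemma hull_by_discs:
  fixes f g h :: "nat \<Rightarrow> complex \<Rightarrow> complex" and u :: "nat \<Rightarrow> complex ^ 3"
  assumes fgh: "\<And>N z. cmod z \<le> 1 \<Longrightarrow> f N field_differentiable at z"
      "\<And>N z. cmod z \<le> 1 \<Longrightarrow> g N field_differentiable at z"
      "\<And>N z. cmod z \<le> 1 \<Longrightarrow> h N field_differentiable at z"
    and nz: "\<And>N z. cmod z \<le> 1 \<Longrightarrow> vector [f N z, g N z, h N z] \<noteq> (0 :: complex ^ 3)"
    and bdry: "\<And>N z. cmod z = 1 \<Longrightarrow> \<exists>\<mu> \<zeta>. cmod \<mu> = 1 \<and> cmod \<zeta> = 1 \<and>
      (vector [f N z, g N z, h N z] :: complex ^ 3) = \<mu> *s vector [1, \<zeta>, omega_part N \<zeta>]"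
    and z0: "cmod z0 \<le> 1" and \<beta>: "\<beta> > 0" "\<And>N. N > 0 \<Longrightarrow> \<beta> \<le> cmod (l N)"
    and center: "\<And>N. N > 0 \<Longrightarrow> vector [f N z0, g N z0, h N z0] = l N *s u N"
    and lim: "u \<longlonglongrightarrow> v" and v: "v \<noteq> 0"
  shows "cproj_of v \<in> projective_hull (gamma0 eps c)"
  unfolding projective_hull_def
proof (intro CollectI exI conjI allI impI ballI)
  let ?M = "tail 0 + 3"
  show "0 < ?M / (\<beta> * norm v)"
    using \<beta>(1) v tail_nonneg[of 0] by simp
  fix d :: nat and F :: "complex ^ 3 \<Rightarrow> complex"
  assume F: "F \<in> sections_O d"
  let ?S = "SUP y\<in>gamma0 eps c. section_norm d F y"
  have "\<beta> ^ d * cmod (F v) \<le> ?M ^ d * ?S"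
  proof (rule field_le_epsilon)
    fix \<delta> :: real assume "\<delta> > 0"
    \<comment> \<open>The section on the curve of \<open>\<omega>\<^sub>N\<close> is eventually within \<open>\<delta>\<close> of the section on the limit curve.\<close>
    have "uniformly_continuous_on (chart_ball ?M) F"
      by (intro compact_uniformly_continuous section_continuous_on_chart_ball[OF F] compact_chart_ball)
    then obtain \<eta> where \<eta>: "\<eta> > 0"
      "\<And>x y. x \<in> chart_ball ?M \<Longrightarrow> y \<in> chart_ball ?M \<Longrightarrow> dist y x < \<eta> \<Longrightarrow> dist (F y) (F x) < \<delta>"
      unfolding uniformly_continuous_on_def using \<open>\<delta> > 0\<close> by meson
    have "\<forall>\<^sub>F N in sequentially. tail N < min \<eta> 1"
      using tail_tendsto_0 \<eta>(1) by (intro order_tendstoD) auto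
    then have "\<forall>\<^sub>F N in sequentially. \<beta> ^ d * cmod (F (u N)) \<le> ?M ^ d * ?S + \<delta>"
      using eventually_gt_at_top[of 0]
    proof eventually_elim
      case (elim N)
      have circle: "cmod (F (vector [1, \<zeta>, omega_part N \<zeta>])) \<le> ?M ^ d * ?S + \<delta>" if \<zeta>: "cmod \<zeta> = 1" for \<zeta>
      proof -
        let ?x = "vector [1, \<zeta>, omega eps c \<zeta>] :: complex ^ 3"
        let ?y = "vector [1, \<zeta>, omega_part N \<zeta>] :: complex ^ 3"
        have diff: "cmod (omega_part N \<zeta> - omega eps c \<zeta>) < min \<eta> 1"
          using omega_minus_part_le_tail[of \<zeta> N] \<zeta> elim(1) by (simp add: norm_minus_commute)
        have "?y - ?x = vector [0, 0, omega_part N \<zeta> - omega eps c \<zeta>]"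
          by (simp add: vec_eq_iff forall_3)
        then have "dist ?y ?x < \<eta>"
          using norm_vector3_le[of 0 0 "omega_part N \<zeta> - omega eps c \<zeta>"] diff by (simp add: dist_norm)
        moreover have "cmod (omega_part N \<zeta>) \<le> tail 0 + 1"
          using diff omega_bound[of \<zeta>] \<zeta> norm_triangle_sub[of "omega_part N \<zeta>" "omega eps c \<zeta>"] by simp
        ultimately have "dist (F ?y) (F ?x) < \<delta>"
          using \<zeta> omega_bound[of \<zeta>] by (intro \<eta>(2) curve_in_chart_ball) auto
        then show ?thesis
          using section_on_curve_le[OF F \<zeta>] norm_triangle_sub[of "F ?y" "F ?x"] by (simp add: dist_norm)
      qed
      have "cmod (F (vector [f N z0, g N z0, h N z0])) \<le> ?M ^ d * ?S + \<delta>"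
      proof (rule section_maximum_principle[OF F _ _ _ _ _ z0, of "f N" "g N" "h N"])
        fix z :: complex
        assume "cmod z = 1"
        then obtain \<mu> \<zeta> where \<mu>: "cmod \<mu> = 1" "cmod \<zeta> = 1"
          "(vector [f N z, g N z, h N z] :: complex ^ 3) = \<mu> *s vector [1, \<zeta>, omega_part N \<zeta>]"
          using bdry by blast
        then have "\<mu> \<noteq> 0"
          by auto
        then show "cmod (F (vector [f N z, g N z, h N z])) \<le> ?M ^ d * ?S + \<delta>"
          unfolding \<mu>(3) using circle[OF \<mu>(2)] \<mu>(1)
          by (simp add: section_scale[OF F affine_pt_vector_nz] norm_mult norm_power)
      qed (use fgh nz in auto)
      moreover have "u N \<noteq> 0" and "l N \<noteq> 0"
        using nz[OF z0, of N] \<beta>(1) \<beta>(2)[OF elim(2)] unfolding center[OF elim(2)] by (auto simp: vec_eq_iff)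
      ultimately have "cmod (l N) ^ d * cmod (F (u N)) \<le> ?M ^ d * ?S + \<delta>"
        unfolding center[OF elim(2)] by (simp add: section_scale[OF F] norm_mult norm_power)
      moreover have "\<beta> ^ d * cmod (F (u N)) \<le> cmod (l N) ^ d * cmod (F (u N))"
        using \<beta>(1) \<beta>(2)[OF elim(2)] by (intro mult_right_mono power_mono) auto
      ultimately show ?case
        by simp
    qed
    moreover have "(\<lambda>N. \<beta> ^ d * cmod (F (u N))) \<longlonglongrightarrow> \<beta> ^ d * cmod (F v)"
      by (intro tendsto_intros isCont_tendsto_compose[OF section_continuous[OF F v] lim])
    ultimately show "\<beta> ^ d * cmod (F v) \<le> ?M ^ d * ?S + \<delta>"
      by (intro tendsto_upperbound) auto
  qed
  then have "cmod (F v) \<le> ?M ^ d * ?S / \<beta> ^ d"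
    using \<beta>(1) by (simp add: pos_le_divide_eq mult.commute)
  then have "cmod (F v) / norm v ^ d \<le> ?M ^ d * ?S / \<beta> ^ d / norm v ^ d"
    using v by (intro divide_right_mono) auto
  then show "section_norm d F (cproj_of v) \<le> (?M / (\<beta> * norm v)) ^ d * ?S"
    unfolding section_norm_cproj_of[OF F v] by (simp add: power_divide power_mult_distrib)
qed

text \<open>
  Homogeneous denominator and numerator of \<open>\<omega>\<^sub>N\<close>: the quotient \<open>num N s z / den N s z\<close> is
  \<open>s \<omega>\<^sub>N(z/s)\<close>.  With the arguments of \<open>den\<close> exchanged one gets the reflected product
  \<open>\<Prod>(1 - a\<^sub>j z)\<close>, so that \<open>den N 1 z / den N z 1\<close> is the Blaschke product of the first \<open>N\<close> poles.
\<close>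

definition den :: "nat \<Rightarrow> complex \<Rightarrow> complex \<Rightarrow> complex" where
  "den N s z = (\<Prod>j<N. z - a j * s)"

section \<open>Blaschke products and the discs\<close>

lemma pole_eq_iff: "pole eps i = pole eps j \<longleftrightarrow> i = j"
  using a_eq_iff by auto

definition num :: "nat \<Rightarrow> complex \<Rightarrow> complex \<Rightarrow> complex" where
  "num N s z = (\<Sum>j<N. of_real (c j / pole eps j)) * s * den N s z
     + s\<^sup>2 * (\<Sum>j<N. of_real (c j) * (\<Prod>i\<in>{..<N}-{j}. z - a i * s))"

lemma num_eq:
  assumes s: "s \<noteq> 0" and nz: "\<And>j. j < N \<Longrightarrow> z \<noteq> a j * s"
  shows "num N s z = s * den N s z * omega_part N (z / s)"
proof -
  have "s\<^sup>2 * (of_real (c j) * (\<Prod>i\<in>{..<N}-{j}. z - a i * s))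
      = s * den N s z * (of_real (c j) / (z / s - a j))" if "j < N" for j
  proof -
    have den: "den N s z = (z - a j * s) * (\<Prod>i\<in>{..<N}-{j}. z - a i * s)"
      unfolding den_def using that by (subst prod.remove[of _ j]) auto
    have "z / s - a j = (z - a j * s) / s"
      using s by (simp add: field_simps)
    then show ?thesis
      unfolding den using s nz[OF that] by (simp add: power2_eq_square)
  qed
  then have "s\<^sup>2 * (\<Sum>j<N. of_real (c j) * (\<Prod>i\<in>{..<N}-{j}. z - a i * s))
      = s * den N s z * (\<Sum>j<N. of_real (c j) / (z / s - a j))"
    unfolding sum_distrib_left by (intro sum.cong) auto
  then show ?thesis
    unfolding num_def omega_part_def by (simp add: algebra_simps)
qed

lemma den_at_pole:
  assumes "k < N"
  shows "den N 1 (a k) = 0"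
  unfolding den_def using assms by (intro prod_zero) auto

text \<open>
  Only the term of the pole itself survives.  It is not zero, so the numerator and the denominator
  have no common zero.
\<close>

lemma num_at_pole:
  assumes k: "k < N"
  shows "num N 1 (a k) = of_real (c k) * (\<Prod>i\<in>{..<N}-{k}. a k - a i)"
proof -
  have "(\<Prod>i\<in>{..<N}-{j}. a k - a i) = 0" if "j \<noteq> k" for j
    using that k by (intro prod_zero) auto
  then have "(\<Sum>j<N. of_real (c j) * (\<Prod>i\<in>{..<N}-{j}. a k - a i))
      = (\<Sum>j<N. if j = k then of_real (c k) * (\<Prod>i\<in>{..<N}-{k}. a k - a i) else 0)"
    by (intro sum.cong) auto
  then show ?thesis
    using k den_at_pole[OF k] by (simp add: num_def)
qed

lemma den_nonzero:
  assumes "z \<notin> range a"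
  shows "den N 1 z \<noteq> 0"
  using assms by (auto simp: den_def)

lemma factor_reflected_nonzero:
  assumes "cmod z \<le> 1"
  shows "1 - a j * z \<noteq> 0"
proof
  assume "1 - a j * z = 0"
  then have "1 = cmod (a j * z)"
    by simp
  also have "\<dots> \<le> pole eps j * 1"
    unfolding norm_mult norm_a using assms pole_pos[of j] by (intro mult_left_mono) auto
  finally show False
    using pole_lt_1[of j] by simp
qed

lemma den_reflected_nonzero:
  assumes "cmod z \<le> 1"
  shows "den N z 1 \<noteq> 0"
  using factor_reflected_nonzero[OF assms] by (simp add: den_def)

lemma norm_den_reflected:
  assumes z: "cmod z = 1"
  shows "cmod (den N z 1) = cmod (den N 1 z)"
proof -
  have "cmod (1 - a j * z) = cmod (z - a j)" for j
  proof -
    have "1 - a j * z = z * cnj (z - a j)"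
      using z by (simp add: algebra_simps complex_norm_square[symmetric])
    then have "cmod (1 - a j * z) = cmod (cnj (z - a j))"
      using z by (simp only: norm_mult)
    then show ?thesis
      by (simp only: complex_mod_cnj)
  qed
  then show ?thesis
    by (simp add: den_def prod_norm[symmetric])
qed

text \<open>
  A factor differs from \<open>-1\<close> by at most a multiple of \<open>\<epsilon>\<^sub>j\<close>, so the product of the nonzero factors
  converges to a nonzero limit.  The factor that vanishes when \<open>z\<close> is a pole is replaced by \<open>1\<close>,
  which allows the centre of the disc to be a pole.
\<close>

lemma blaschke_bounded_below:
  assumes z: "cmod z < 1"
  obtains \<beta> where "\<beta> > 0" "\<And>N. \<beta> \<le> cmod (\<Prod>j<N. if z = a j then 1 else (z - a j) / (1 - a j * z))"
proof -
  \<comment> \<open>The sign is chosen such that the factors tend to \<open>1\<close>.\<close>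
  define b where "b j = (if z = a j then 1 else (a j - z) / (1 - a j * z))" for j
  have b_nz: "b j \<noteq> 0" for j
    using factor_reflected_nonzero[of z j] z by (auto simp: b_def)
  have "summable (\<lambda>j. norm (b j - 1))"
  proof (rule summable_comparison_test'[OF summable_mult[OF summable_eps, of "2 / (1 - cmod z)"]])
    fix j
    show "norm (norm (b j - 1)) \<le> 2 / (1 - cmod z) * eps j"
    proof (cases "z = a j")
      case True
      then show ?thesis
        using z eps_pos[of j] by (simp add: b_def)
    next
      case False
      have nz: "1 - a j * z \<noteq> 0"
        using z by (intro factor_reflected_nonzero) simp
      have "a j - z - (1 - a j * z) = - ((1 - a j) * (1 + z))"
        by (simp add: algebra_simps)
      then have "b j - 1 = - ((1 - a j) * (1 + z)) / (1 - a j * z)"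
        using False nz by (metis b_def diff_divide_distrib divide_self)
      then have eq: "cmod (b j - 1) = eps j * cmod (1 + z) / cmod (1 - a j * z)"
        by (simp only: norm_divide norm_minus_cancel norm_mult norm_1_minus_a)
      have "cmod (a j * z) \<le> cmod z"
        unfolding norm_mult norm_a using pole_pos[of j] pole_lt_1[of j] by (simp add: mult_left_le_one_le)
      then have "1 - cmod z \<le> cmod (1 - a j * z)"
        using norm_triangle_ineq2[of 1 "a j * z"] by simp
      moreover have "cmod (1 + z) \<le> 2"
        using norm_triangle_ineq[of 1 z] z by simp
      ultimately have "eps j * cmod (1 + z) / cmod (1 - a j * z) \<le> eps j * 2 / (1 - cmod z)"
        using z eps_pos[of j] by (intro frac_le mult_left_mono mult_nonneg_nonneg) auto
      then have "cmod (b j - 1) \<le> eps j * 2 / (1 - cmod z)"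
        unfolding eq .
      then show ?thesis
        by (simp add: mult.commute)
    qed
  qed
  then have "convergent_prod b"
    by (intro abs_convergent_prod_imp_convergent_prod summable_imp_abs_convergent_prod)
  then have "(\<lambda>N. \<Prod>j<N. b j) \<longlonglongrightarrow> prodinf b"
    using convergent_prod_LIMSEQ[of b] LIMSEQ_lessThan_iff_atMost[of "prod b" "prodinf b"] by simp
  then have "(\<lambda>N. cmod (\<Prod>j<N. b j)) \<longlonglongrightarrow> cmod (prodinf b)"
    by (rule tendsto_norm)
  moreover have "cmod (prodinf b) > 0"
    using prodinf_nonzero[OF \<open>convergent_prod b\<close>] b_nz by simp
  ultimately obtain \<beta> where \<beta>: "\<beta> > 0" "\<And>N. \<beta> \<le> cmod (\<Prod>j<N. b j)"
    by (rule tendsto_positive_bounded_below) (use b_nz in auto)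
  have "cmod (\<Prod>j<N. b j) = cmod (\<Prod>j<N. if z = a j then 1 else (z - a j) / (1 - a j * z))" for N
    unfolding prod_norm[symmetric] by (intro prod.cong) (auto simp: b_def norm_divide norm_minus_commute)
  then show ?thesis
    using \<beta> that by simp
qed

lemma field_differentiable_den:
  "den N 1 field_differentiable at z" "(\<lambda>z. den N z 1) field_differentiable at z"
  unfolding den_def
  by (rule holomorphic_on_imp_differentiable_at[of _ UNIV]; auto intro!: holomorphic_intros)+

lemma field_differentiable_num:
  "num N 1 field_differentiable at z" "(\<lambda>z. num N z 1) field_differentiable at z"
  unfolding num_def den_def
  by (rule holomorphic_on_imp_differentiable_at[of _ UNIV]; auto intro!: holomorphic_intros)+

text \<open>
  The disc \<open>B\<^sub>N(z) (1, z, \<omega>\<^sub>N(z))\<close>: the Blaschke product cancels the poles of \<open>\<omega>\<^sub>N\<close> and has modulus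
  \<open>1\<close> on the circle.
\<close>

lemma hull_by_inner_discs:
  assumes z0: "cmod z0 < 1" and \<beta>: "\<beta> > 0" "\<And>N. N > 0 \<Longrightarrow> \<beta> \<le> cmod (l N)"
    and center: "\<And>N. N > 0 \<Longrightarrow>
      vector [den N 1 z0 / den N z0 1, z0 * (den N 1 z0 / den N z0 1), num N 1 z0 / den N z0 1]
        = l N *s (u N :: complex ^ 3)"
    and lim: "u \<longlonglongrightarrow> v" "v \<noteq> 0"
  shows "cproj_of v \<in> projective_hull (gamma0 eps c)"
proof (rule hull_by_discs[of "\<lambda>N z. den N 1 z / den N z 1" "\<lambda>N z. z * (den N 1 z / den N z 1)"
      "\<lambda>N z. num N 1 z / den N z 1", OF _ _ _ _ _ _ \<beta> center lim])
  fix N and z :: complex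
  assume z: "cmod z \<le> 1"
  note nz = den_reflected_nonzero[OF z, of N]
  show 1: "(\<lambda>z. den N 1 z / den N z 1) field_differentiable at z"
    using nz by (intro field_differentiable_divide field_differentiable_den)
  then show "(\<lambda>z. z * (den N 1 z / den N z 1)) field_differentiable at z"
    by (intro field_differentiable_mult field_differentiable_ident)
  show "(\<lambda>z. num N 1 z / den N z 1) field_differentiable at z"
    using nz by (intro field_differentiable_divide field_differentiable_den field_differentiable_num)
  show "vector [den N 1 z / den N z 1, z * (den N 1 z / den N z 1), num N 1 z / den N z 1] \<noteq> (0 :: complex ^ 3)"
  proof (cases "den N 1 z = 0")
    case True
    then obtain k where k: "k < N" "z = a k"
      by (auto simp: den_def)
    have "num N 1 z \<noteq> 0"
      using k c_pos[of k] unfolding k(2) num_at_pole[OF k(1)] by (auto simp: pole_eq_iff)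
    then show ?thesis
      using nz by (simp add: vector3_nonzero)
  qed (use nz in \<open>simp add: vector3_nonzero\<close>)
next
  fix N and z :: complex
  assume z: "cmod z = 1"
  have nonpole: "z \<notin> range a"
    using z by (intro outside_nonpole) simp
  have "num N 1 z = 1 * den N 1 z * omega_part N (z / 1)"
    using nonpole by (intro num_eq) auto
  moreover have "cmod (den N 1 z / den N z 1) = 1"
    using norm_den_reflected[OF z, of N] den_nonzero[OF nonpole, of N] by (simp add: norm_divide)
  ultimately show "\<exists>\<mu> \<zeta>. cmod \<mu> = 1 \<and> cmod \<zeta> = 1 \<and>
      (vector [den N 1 z / den N z 1, z * (den N 1 z / den N z 1), num N 1 z / den N z 1] :: complex ^ 3)
        = \<mu> *s vector [1, \<zeta>, omega_part N \<zeta>]"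
    using z by (intro exI[of _ "den N 1 z / den N z 1"] exI[of _ z]) (simp add: vec_eq_iff forall_3)
qed (use z0 in auto)

lemma inner_graph_in_hull:
  assumes z: "cmod z < 1" "z \<notin> range a"
  shows "affine_pt z (omega eps c z) \<in> projective_hull (gamma0 eps c)"
proof -
  obtain \<beta> where \<beta>: "\<beta> > 0"
    "\<And>N. \<beta> \<le> cmod (\<Prod>j<N. if z = a j then 1 else (z - a j) / (1 - a j * z))"
    by (rule blaschke_bounded_below[OF z(1)]) blast
  have prod: "(\<Prod>j<N. if z = a j then 1 else (z - a j) / (1 - a j * z)) = den N 1 z / den N z 1" for N
    unfolding den_def prod_dividef[symmetric] using z(2) by (intro prod.cong) auto
  have num: "num N 1 z = 1 * den N 1 z * omega_part N (z / 1)" for N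
    using z(2) by (intro num_eq) auto
  show ?thesis
    unfolding affine_pt_def
  proof (rule hull_by_inner_discs[OF z(1) \<beta>(1)])
    show "\<beta> \<le> cmod (den N 1 z / den N z 1)" for N
      using \<beta>(2)[of N] unfolding prod .
    show "vector [den N 1 z / den N z 1, z * (den N 1 z / den N z 1), num N 1 z / den N z 1]
        = (den N 1 z / den N z 1) *s (vector [1, z, omega_part N z] :: complex ^ 3)" for N
      by (simp add: vector3_scale num mult.commute)
    show "(\<lambda>N. vector [1, z, omega_part N z] :: complex ^ 3) \<longlonglongrightarrow> vector [1, z, omega eps c z]"
      by (intro tendsto_vector3 tendsto_const omega_part_tendsto[OF z(2)])
  qed simp
qed

text \<open>
  At a pole the disc \<open>B\<^sub>N(z) (1, z, \<omega>\<^sub>N(z))\<close> takes the value \<open>(0, 0, l\<^sub>N)\<close>, where \<open>l\<^sub>N\<close> is the residue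
  times the Blaschke product without its vanishing factor.
\<close>

lemma ell_in_hull: "pt_ell \<in> projective_hull (gamma0 eps c)"
proof -
  let ?z = "a 0" and ?\<kappa> = "of_real (c 0) / (1 - a 0 * a 0)"
  let ?b = "\<lambda>j. if ?z = a j then 1 else (?z - a j) / (1 - a j * ?z)"
  have z: "cmod ?z < 1"
    using norm_a[of 0] pole_lt_1[of 0] by simp
  obtain \<beta> where \<beta>: "\<beta> > 0" "\<And>N. \<beta> \<le> cmod (\<Prod>j<N. ?b j)"
    by (rule blaschke_bounded_below[OF z]) blast
  have \<kappa>: "?\<kappa> \<noteq> 0"
    using factor_reflected_nonzero[of ?z 0] z c_pos[of 0] by simp
  have disc_value: "num N 1 ?z / den N ?z 1 = ?\<kappa> * (\<Prod>j<N. ?b j)" if N: "N > 0" for N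
  proof -
    have "(\<Prod>j<N. ?b j) = (\<Prod>j\<in>{..<N}-{0}. ?b j)"
      using N by (subst prod.remove[of _ 0]) auto
    also have "\<dots> = (\<Prod>j\<in>{..<N}-{0}. ?z - a j) / (\<Prod>j\<in>{..<N}-{0}. 1 - a j * ?z)"
      unfolding prod_dividef[symmetric] by (intro prod.cong) (auto simp: pole_eq_iff)
    finally have B: "(\<Prod>j<N. ?b j) = (\<Prod>j\<in>{..<N}-{0}. ?z - a j) / (\<Prod>j\<in>{..<N}-{0}. 1 - a j * ?z)" .
    have "den N ?z 1 = (1 - ?z * ?z) * (\<Prod>j\<in>{..<N}-{0}. 1 - a j * ?z)"
      unfolding den_def using N by (subst prod.remove[of _ 0]) auto
    then show ?thesis
      unfolding B num_at_pole[OF N] by simp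
  qed
  show ?thesis
    unfolding pt_ell_def
  proof (rule hull_by_inner_discs[OF z, of "cmod ?\<kappa> * \<beta>" "\<lambda>N. num N 1 ?z / den N ?z 1" "\<lambda>N. vector [0, 0, 1]"])
    show "0 < cmod ?\<kappa> * \<beta>"
      using \<beta>(1) \<kappa> by simp
    show "cmod ?\<kappa> * \<beta> \<le> cmod (num N 1 ?z / den N ?z 1)" if "N > 0" for N
      unfolding disc_value[OF that] norm_mult by (intro mult_left_mono \<beta>(2)) simp
    show "vector [den N 1 ?z / den N ?z 1, ?z * (den N 1 ?z / den N ?z 1), num N 1 ?z / den N ?z 1]
        = (num N 1 ?z / den N ?z 1) *s (vector [0, 0, 1] :: complex ^ 3)" if "N > 0" for N
      using den_at_pole[OF that] by (simp add: vector3_scale)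
  qed (auto simp: vector3_nonzero)
qed

text \<open>
  The disc \<open>t (1, 1/t, \<omega>\<^sub>N(1/t))\<close> covers the outside of the unit disc, including \<open>t = 0\<close>, the point
  over \<open>\<zeta> = \<infinity>\<close>.
\<close>

lemma hull_by_outer_discs:
  assumes t: "cmod t \<le> 1"
    and lim: "(\<lambda>N. vector [t, 1, num N t 1 / den N t 1] :: complex ^ 3) \<longlonglongrightarrow> v" "v \<noteq> 0"
  shows "cproj_of v \<in> projective_hull (gamma0 eps c)"
proof (rule hull_by_discs[of "\<lambda>N t. t" "\<lambda>N t. 1" "\<lambda>N t. num N t 1 / den N t 1" t 1 "\<lambda>_. 1"
      "\<lambda>N. vector [t, 1, num N t 1 / den N t 1]", OF _ _ _ _ _ t _ _ _ lim])
  fix N and z :: complex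
  assume z: "cmod z = 1"
  then have "z \<noteq> 0"
    by auto
  have "num N z 1 = z * den N z 1 * omega_part N (1 / z)"
    using z factor_reflected_nonzero[of z] by (intro num_eq) auto
  then have "num N z 1 / den N z 1 = z * omega_part N (1 / z)"
    using den_reflected_nonzero[of z N] z by simp
  then show "\<exists>\<mu> \<zeta>. cmod \<mu> = 1 \<and> cmod \<zeta> = 1 \<and>
      (vector [z, 1, num N z 1 / den N z 1] :: complex ^ 3) = \<mu> *s vector [1, \<zeta>, omega_part N \<zeta>]"
    using z \<open>z \<noteq> 0\<close> by (intro exI[of _ z] exI[of _ "1 / z"]) (simp add: vector3_scale norm_divide)
qed (auto simp: vector3_nonzero vector3_scale
    intro!: field_differentiable_divide field_differentiable_den field_differentiable_num den_reflected_nonzero)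

lemma outer_graph_in_hull:
  assumes z: "1 \<le> cmod z"
  shows "affine_pt z (omega eps c z) \<in> projective_hull (gamma0 eps c)"
proof -
  have "z \<noteq> 0"
    using z by auto
  have t: "cmod (1 / z) \<le> 1"
    using z by (simp add: norm_divide divide_le_eq_1)
  have disc_value: "num N (1 / z) 1 / den N (1 / z) 1 = 1 / z * omega_part N z" for N
  proof -
    have "num N (1 / z) 1 = 1 / z * den N (1 / z) 1 * omega_part N (1 / (1 / z))"
      using \<open>z \<noteq> 0\<close> factor_reflected_nonzero[OF t] by (intro num_eq) auto
    then show ?thesis
      using den_reflected_nonzero[OF t, of N] by simp
  qed
  have "cproj_of ((1 / z) *s vector [1, z, omega eps c z]) \<in> projective_hull (gamma0 eps c)"
  proof (rule hull_by_outer_discs[OF t])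
    have "(\<lambda>N. vector [1 / z, 1, 1 / z * omega_part N z] :: complex ^ 3)
        \<longlonglongrightarrow> vector [1 / z, 1, 1 / z * omega eps c z]"
      by (intro tendsto_vector3 tendsto_mult tendsto_const omega_part_tendsto outside_nonpole z)
    then show "(\<lambda>N. vector [1 / z, 1, num N (1 / z) 1 / den N (1 / z) 1] :: complex ^ 3)
        \<longlonglongrightarrow> (1 / z) *s vector [1, z, omega eps c z]"
      unfolding disc_value vector3_scale using \<open>z \<noteq> 0\<close> by simp
    show "(1 / z) *s vector [1, z, omega eps c z] \<noteq> (0 :: complex ^ 3)"
      using \<open>z \<noteq> 0\<close> by (simp add: vector3_scale vector3_nonzero)
  qed
  then show ?thesis
    using \<open>z \<noteq> 0\<close> by (simp add: affine_pt_def cproj_of_scale)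
qed

lemma horizontal_in_hull: "pt_horizontal \<in> projective_hull (gamma0 eps c)"
  unfolding pt_horizontal_def
  by (rule hull_by_outer_discs[of 0]) (simp_all add: num_def vector3_nonzero)

lemma graph_in_hull:
  assumes "z \<notin> range a"
  shows "affine_pt z (omega eps c z) \<in> projective_hull (gamma0 eps c)"
  using inner_graph_in_hull[of z] outer_graph_in_hull[of z] assms by force

section \<open>The closure of the graph\<close>

definition graph_set :: "(complex \<times> complex) set" where
  "graph_set = {(\<zeta>, omega eps c \<zeta>) | \<zeta>. \<zeta> \<noteq> 1 \<and> \<zeta> \<notin> range a}"

lemma graph_omega_eq: "graph_omega eps c = (\<lambda>(z, w). affine_pt z w) ` graph_set"
  unfolding graph_omega_def graph_set_def by (auto simp: image_iff)

lemma curve_W_eq: "curve_W eps c = closure (graph_omega eps c) - line_L"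
proof -
  have "graph_omega eps c \<subseteq> - line_L"
    by (auto simp: graph_omega_def affine_pt_in_line_L_iff)
  then show ?thesis
    unfolding curve_W_def closure_of_subtopology euclidean_closure_of
    by (simp add: Int_absorb1 Diff_eq Int_commute)
qed

definition rest :: "nat \<Rightarrow> complex \<Rightarrow> complex" where
  "rest j \<zeta> = (\<Sum>i. if i = j then 0 else of_real (c i) / (\<zeta> - a i))"

lemma omega_split:
  assumes "\<zeta> \<notin> range a"
  shows "omega eps c \<zeta> = of_real (c j) / (\<zeta> - a j) + rest j \<zeta> + (\<Sum>i. of_real (c i / pole eps i))"
proof -
  let ?f = "\<lambda>i. of_real (c i) / (\<zeta> - a i)"
  have "?f sums suminf ?f"
    by (intro summable_sums summable_norm_cancel[OF summable_terms_nonpole[OF assms]])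
  then have "(\<lambda>i. ?f i - (if i = j then ?f i else 0)) sums (suminf ?f - ?f j)"
    by (intro sums_diff sums_single)
  moreover have "(\<lambda>i. ?f i - (if i = j then ?f i else 0)) = (\<lambda>i. if i = j then 0 else ?f i)"
    by auto
  ultimately have "rest j \<zeta> = suminf ?f - ?f j"
    unfolding rest_def by (simp add: sums_iff)
  then show ?thesis
    by (simp add: omega_def)
qed

text \<open>
  Dominated convergence, with \<open>c\<^sub>i / \<epsilon>\<^sub>i\<close> as dominating series.  The removed pole may vary with \<open>n\<close>:
  it is constant when limits of the graph at a fixed point are studied, and it is the nearest pole
  when \<open>\<zeta>\<close> approaches \<open>1\<close>.
\<close>

lemma rest_tendsto:
  assumes \<kappa>: "\<kappa> > 0"
    and dist: "\<forall>\<^sub>F n in sequentially. \<forall>i. i \<noteq> j n \<longrightarrow> \<kappa> * eps i \<le> cmod (\<zeta> n - a i)"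
    and lim: "\<And>i. (\<lambda>n. if i = j n then 0 else of_real (c i) / (\<zeta> n - a i)) \<longlonglongrightarrow> b i"
  shows "(\<lambda>n. rest (j n) (\<zeta> n)) \<longlonglongrightarrow> suminf b"
proof -
  have dominated: "norm (if i = j n then 0 else of_real (c i) / (\<zeta> n - a i)) \<le> 1 / \<kappa> * (c i / eps i)"
    if "\<forall>i. i \<noteq> j n \<longrightarrow> \<kappa> * eps i \<le> cmod (\<zeta> n - a i)" for i n
  proof (cases "i = j n")
    case False
    have "0 < \<kappa> * eps i"
      using \<kappa> eps_pos[of i] by simp
    then have "c i / cmod (\<zeta> n - a i) \<le> c i / (\<kappa> * eps i)"
      using that False c_pos[of i] by (intro frac_le) auto
    then show ?thesis
      using False c_pos[of i] by (simp add: norm_divide)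
  qed (use \<kappa> c_pos[of i] eps_pos[of i] in simp)
  have "\<forall>\<^sub>F (i, n) in sequentially \<times>\<^sub>F sequentially.
      norm (if i = j n then 0 else of_real (c i) / (\<zeta> n - a i)) \<le> 1 / \<kappa> * (c i / eps i)"
    unfolding eventually_prod_filter
  proof (intro exI conjI allI impI)
    show "\<forall>\<^sub>F i in sequentially. True"
      by simp
    show "\<forall>\<^sub>F n in sequentially. \<forall>i. i \<noteq> j n \<longrightarrow> \<kappa> * eps i \<le> cmod (\<zeta> n - a i)"
      by (rule dist)
  qed (use dominated in auto)
  from tannerys_theorem[OF lim this summable_mult[OF summable_c_eps] sequentially_bot]
  show ?thesis
    unfolding rest_def by blast
qed

text \<open>
  Away from \<open>z = 1\<close> the graph is closed.  At a pole \<open>a\<^sub>j\<close> the equation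
  \<open>(\<zeta> - a\<^sub>j) \<omega>(\<zeta>) = c\<^sub>j + (\<zeta> - a\<^sub>j) (\<dots>)\<close> would give \<open>0 = c\<^sub>j\<close> in the limit.
\<close>

lemma closure_graph_setD:
  assumes zw: "(z, w) \<in> closure graph_set" and z: "z \<noteq> 1"
  shows "z \<notin> range a \<and> w = omega eps c z"
proof -
  obtain q where q: "\<And>n. q n \<in> graph_set" "q \<longlonglongrightarrow> (z, w)"
    using zw unfolding closure_sequential by blast
  define \<zeta> where "\<zeta> n = fst (q n)" for n
  have \<zeta>: "\<zeta> n \<notin> range a" "q n = (\<zeta> n, omega eps c (\<zeta> n))" for n
    using q(1)[of n] by (auto simp: \<zeta>_def graph_set_def)
  have \<zeta>_lim: "\<zeta> \<longlonglongrightarrow> z"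
    using tendsto_fst[OF q(2)] by (simp add: \<zeta>_def[abs_def])
  have \<omega>_lim: "(\<lambda>n. omega eps c (\<zeta> n)) \<longlonglongrightarrow> w"
    using tendsto_snd[OF q(2)] \<zeta>(2) by simp
  define K where "K = (\<Sum>i. of_real (c i / pole eps i) :: complex)"
  obtain \<delta> where \<delta>: "\<delta> > 0" "\<And>i. z \<noteq> a i \<Longrightarrow> \<delta> \<le> cmod (z - a i)"
    by (rule pole_distance_away[OF z]) blast
  have rest_lim: "(\<lambda>n. rest j (\<zeta> n)) \<longlonglongrightarrow> rest j z" if j: "\<And>i. i \<noteq> j \<Longrightarrow> z \<noteq> a i" for j
    unfolding rest_def[of j z]
  proof (rule rest_tendsto)
    show "0 < \<delta> / 2"
      using \<delta> by simp
    have "\<forall>\<^sub>F n in sequentially. dist (\<zeta> n) z < \<delta> / 2"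
      using \<zeta>_lim \<delta>(1) by (intro tendstoD) auto
    then show "\<forall>\<^sub>F n in sequentially. \<forall>i. i \<noteq> j \<longrightarrow> \<delta> / 2 * eps i \<le> cmod (\<zeta> n - a i)"
    proof eventually_elim
      case (elim n)
      show ?case
      proof (intro allI impI)
        fix i assume "i \<noteq> j"
        then have "\<delta> \<le> cmod (z - a i)"
          using \<delta>(2) j by blast
        also have "\<dots> \<le> cmod (z - \<zeta> n) + cmod (\<zeta> n - a i)"
          using norm_triangle_ineq[of "z - \<zeta> n" "\<zeta> n - a i"] by simp
        finally have "\<delta> / 2 \<le> cmod (\<zeta> n - a i)"
          using elim by (simp add: dist_norm norm_minus_commute)
        moreover have "\<delta> / 2 * eps i \<le> \<delta> / 2"
          using \<delta>(1) eps_lt_1[of i] by simp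
        ultimately show "\<delta> / 2 * eps i \<le> cmod (\<zeta> n - a i)"
          by simp
      qed
    qed
    show "(\<lambda>n. if i = j then 0 else of_real (c i) / (\<zeta> n - a i))
        \<longlonglongrightarrow> (if i = j then 0 else of_real (c i) / (z - a i))" for i
      using j[of i] \<zeta>_lim by (auto intro!: tendsto_intros)
  qed
  have "z \<notin> range a"
  proof
    assume "z \<in> range a"
    then obtain j where j: "z = a j"
      by blast
    have "(\<lambda>n. (\<zeta> n - a j) * omega eps c (\<zeta> n)) = (\<lambda>n. of_real (c j) + (\<zeta> n - a j) * (rest j (\<zeta> n) + K))"
    proof
      fix n
      have "\<zeta> n - a j \<noteq> 0"
        using \<zeta>(1)[of n] by auto
      then show "(\<zeta> n - a j) * omega eps c (\<zeta> n) = of_real (c j) + (\<zeta> n - a j) * (rest j (\<zeta> n) + K)"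
        unfolding omega_split[OF \<zeta>(1), of n j] K_def by (simp add: distrib_left)
    qed
    moreover have "(\<lambda>n. of_real (c j) + (\<zeta> n - a j) * (rest j (\<zeta> n) + K))
        \<longlonglongrightarrow> of_real (c j) + (z - a j) * (rest j z + K)"
      by (intro tendsto_intros \<zeta>_lim rest_lim) (simp add: j pole_eq_iff)
    moreover have "(\<lambda>n. (\<zeta> n - a j) * omega eps c (\<zeta> n)) \<longlonglongrightarrow> (z - a j) * w"
      by (intro tendsto_intros \<zeta>_lim \<omega>_lim)
    ultimately have "of_real (c j) + (z - a j) * (rest j z + K) = (z - a j) * w"
      using LIMSEQ_unique by metis
    then show False
      using j c_pos[of j] by simp
  qed
  moreover from this have "z - a 0 \<noteq> 0"
    by auto
  then have "(\<lambda>n. of_real (c 0) / (\<zeta> n - a 0) + rest 0 (\<zeta> n) + K) \<longlonglongrightarrow> of_real (c 0) / (z - a 0) + rest 0 z + K"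
    using \<open>z \<notin> range a\<close> by (intro tendsto_intros \<zeta>_lim rest_lim) auto
  then have "(\<lambda>n. omega eps c (\<zeta> n)) \<longlonglongrightarrow> omega eps c z"
    unfolding K_def omega_split[OF \<zeta>(1), of _ 0] omega_split[OF \<open>z \<notin> range a\<close>, of 0] .
  ultimately show ?thesis
    using LIMSEQ_unique \<omega>_lim by blast
qed

text \<open>
  Since \<open>\<omega>\<close> is bounded on \<open>|\<zeta>| \<ge> 1\<close>, every point of the graph satisfies \<open>|v\<^sub>2| \<le> |v\<^sub>1|\<close> or
  \<open>|v\<^sub>3| \<le> M |v\<^sub>1|\<close>, a closed condition which forces \<open>w = 0\<close> at \<open>(0, 1, w)\<close>.
\<close>

lemma closure_graph_at_infinity:
  assumes "cproj_of (vector [0, 1, w]) \<in> closure (graph_omega eps c)"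
  shows "w = 0"
proof -
  let ?R = "\<lambda>v :: complex ^ 3. cmod (v $ 2) \<le> cmod (v $ 1) \<or> cmod (v $ 3) \<le> tail 0 * cmod (v $ 1)"
  have "?R (vector [0, 1, w])"
  proof (rule closure_homogeneous_condition[OF _ _ _ assms])
    show "closed {v. ?R v}"
      by (intro closed_Collect_disj closed_Collect_le continuous_intros)
    fix v :: "complex ^ 3"
    assume v: "v \<noteq> 0" "cproj_of v \<in> graph_omega eps c"
    then obtain \<zeta> where \<zeta>: "cproj_of v = affine_pt \<zeta> (omega eps c \<zeta>)"
      by (auto simp: graph_omega_def)
    then have eq: "v $ 2 = \<zeta> * v $ 1" "v $ 3 = omega eps c \<zeta> * v $ 1"
      using cproj_of_eq_affine_pt_iff[OF v(1)] by auto
    show "?R v"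
    proof (cases "1 \<le> cmod \<zeta>")
      case True
      then show ?thesis
        using omega_bound[OF True] by (simp add: eq norm_mult mult_right_mono)
    next
      case False
      then show ?thesis
        by (simp add: eq norm_mult mult_left_le_one_le)
    qed
  qed (simp add: vector3_nonzero)
  then show ?thesis
    by simp
qed

lemma horizontal_in_closure_graph: "pt_horizontal \<in> closure (graph_omega eps c)"
  unfolding pt_horizontal_def
proof (rule cproj_of_in_closure)
  define r where "r n = real (Suc (Suc n))" for n
  let ?t = "\<lambda>n. of_real (inverse (r n)) :: complex" and ?z = "\<lambda>n. of_real (r n) :: complex"
  let ?u = "\<lambda>n. vector [?t n, 1, ?t n * omega eps c (?z n)] :: complex ^ 3"
  have r: "1 < r n" for n
    by (simp add: r_def)
  then have norm_z: "cmod (?z n) = r n" for n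
    using less_trans[OF zero_less_one r[of n]] by simp
  have "(\<lambda>n. inverse (r n)) \<longlonglongrightarrow> 0"
    unfolding r_def using LIMSEQ_Suc[OF LIMSEQ_inverse_real_of_nat] .
  from tendsto_of_real[OF this, where 'a = complex] have t: "?t \<longlonglongrightarrow> 0"
    unfolding of_real_0 .
  have z_ge_1: "1 \<le> cmod (?z n)" for n
    using r[of n] norm_z[of n] by simp
  have "\<forall>\<^sub>F n in sequentially. cmod (?t n * omega eps c (?z n)) \<le> cmod (?t n) * tail 0"
    unfolding norm_mult
    by (intro always_eventually allI mult_left_mono omega_bound z_ge_1 norm_ge_zero)
  moreover have "(\<lambda>n. cmod (?t n) * tail 0) \<longlonglongrightarrow> 0"
    using t by (intro tendsto_mult_left_zero tendsto_norm_zero)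
  ultimately have "(\<lambda>n. ?t n * omega eps c (?z n)) \<longlonglongrightarrow> 0"
    by (rule Lim_null_comparison)
  then show "?u \<longlonglongrightarrow> vector [0, 1, 0]"
    by (intro tendsto_vector3 t tendsto_const)
  fix n
  show nz: "?u n \<noteq> 0"
    by (simp add: vector3_nonzero)
  have rn: "r n \<noteq> 0" "r n \<noteq> 1"
    using r[of n] by auto
  then have "cproj_of (?u n) = affine_pt (?z n) (omega eps c (?z n))"
    by (subst cproj_of_eq_affine_pt_iff[OF nz]) simp
  moreover have "?z n \<noteq> 1"
    using rn by simp
  moreover have "?z n \<notin> range a"
    by (intro outside_nonpole z_ge_1)
  ultimately show "cproj_of (?u n) \<in> graph_omega eps c"
    unfolding graph_omega_def by blast
qed simp

lemma curve_W_points: "curve_W eps c = graph_omega eps c \<union> {pt_horizontal}"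
proof
  show "curve_W eps c \<subseteq> graph_omega eps c \<union> {pt_horizontal}"
  proof
    fix x assume "x \<in> curve_W eps c"
    then have x: "x \<in> closure (graph_omega eps c)" "x \<notin> line_L"
      by (auto simp: curve_W_eq)
    show "x \<in> graph_omega eps c \<union> {pt_horizontal}"
    proof (cases x rule: plane_cases)
      case (affine z w)
      then have "z \<noteq> 1"
        using x(2) affine_pt_in_line_L_iff by blast
      moreover have "(z, w) \<in> closure graph_set"
        using x(1) unfolding affine graph_omega_eq by (rule closure_affine_ptD)
      ultimately have "z \<notin> range a \<and> w = omega eps c z"
        by (intro closure_graph_setD)
      with \<open>z \<noteq> 1\<close> have "affine_pt z w \<in> graph_omega eps c"
        unfolding graph_omega_def by blast
      then show ?thesis
        unfolding affine by (rule UnI1)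
    next
      case ell
      then show ?thesis
        using x(2) pt_ell_in_line_L by simp
    next
      case (infinity w)
      then have "w = 0"
        using x(1) closure_graph_at_infinity by blast
      then show ?thesis
        unfolding infinity pt_horizontal_def by simp
    qed
  qed
  have "pt_horizontal \<notin> line_L"
    using line_L_iff[OF pt_horizontal_nz] by (simp add: pt_horizontal_def)
  moreover have "graph_omega eps c \<inter> line_L = {}"
    by (auto simp: graph_omega_def affine_pt_in_line_L_iff)
  ultimately show "graph_omega eps c \<union> {pt_horizontal} \<subseteq> curve_W eps c"
    unfolding curve_W_eq using horizontal_in_closure_graph closure_subset[of "graph_omega eps c"] by blast
qed

lemma curve_W_subset_hull: "curve_W eps c \<union> {pt_ell, pt_p eps c} \<subseteq> projective_hull (gamma0 eps c)"
  unfolding curve_W_points graph_omega_def pt_p_def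
  using graph_in_hull horizontal_in_hull ell_in_hull outer_graph_in_hull[of 1] by auto

section \<open>Sections that separate points from the hull\<close>

text \<open>
  The polynomial \<open>\<Prod>\<^bsub>j<N\<^esub>(z - a\<^sub>j) (w - \<omega>\<^sub>N(z))\<close> made homogeneous of degree \<open>N + 1\<close>.  It vanishes on the
  graph of \<open>\<omega>\<^sub>N\<close>, so it is small on the given curve.
\<close>

definition separating_section :: "nat \<Rightarrow> complex ^ 3 \<Rightarrow> complex" where
  "separating_section N v = den N (v $ 1) (v $ 2) * v $ 3 - num N (v $ 1) (v $ 2)"

lemma den_scale: "den N (k * s) (k * z) = k ^ N * den N s z"
proof -
  have "den N (k * s) (k * z) = (\<Prod>j<N. k * (z - a j * s))"
    unfolding den_def by (intro prod.cong) (auto simp: algebra_simps)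
  then show ?thesis
    by (simp add: prod.distrib den_def)
qed

lemma num_scale: "num N (k * s) (k * z) = k ^ Suc N * num N s z"
proof -
  have "(k * s)\<^sup>2 * (of_real (c j) * (\<Prod>i\<in>{..<N}-{j}. k * z - a i * (k * s)))
      = k ^ Suc N * (s\<^sup>2 * (of_real (c j) * (\<Prod>i\<in>{..<N}-{j}. z - a i * s)))" if "j < N" for j
  proof -
    have "(\<Prod>i\<in>{..<N}-{j}. k * z - a i * (k * s)) = (\<Prod>i\<in>{..<N}-{j}. k * (z - a i * s))"
      by (intro prod.cong) (auto simp: algebra_simps)
    also have "\<dots> = k ^ (N - 1) * (\<Prod>i\<in>{..<N}-{j}. z - a i * s)"
      using that by (simp add: prod.distrib)
    moreover have "k ^ Suc N = k\<^sup>2 * k ^ (N - 1)"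
      using that by (simp flip: power_add)
    ultimately show ?thesis
      by (simp add: power_mult_distrib)
  qed
  then have "(k * s)\<^sup>2 * (\<Sum>j<N. of_real (c j) * (\<Prod>i\<in>{..<N}-{j}. k * z - a i * (k * s)))
      = k ^ Suc N * (s\<^sup>2 * (\<Sum>j<N. of_real (c j) * (\<Prod>i\<in>{..<N}-{j}. z - a i * s)))"
    unfolding sum_distrib_left by (intro sum.cong) auto
  then show ?thesis
    unfolding num_def den_scale by (simp add: algebra_simps)
qed

lemma separating_section_in_sections: "separating_section N \<in> sections_O (Suc N)"
  unfolding sections_O_def
proof (intro CollectI conjI allI impI)
  show "holomorphic_off_0 (separating_section N)"
    unfolding holomorphic_off_0_iff separating_section_def[abs_def] num_def den_def
    by (intro allI impI cdiff_at_intros)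
  show "separating_section N (k *s v) = k ^ Suc N * separating_section N v" for k v
    by (simp add: separating_section_def den_scale num_scale algebra_simps del: power_Suc)
      (simp add: algebra_simps)
qed

lemma separating_section_affine:
  assumes "z \<notin> range a"
  shows "separating_section N (vector [1, z, w]) = den N 1 z * (w - omega_part N z)"
proof -
  have "num N 1 z = 1 * den N 1 z * omega_part N (z / 1)"
    using assms by (intro num_eq) auto
  then show ?thesis
    by (simp add: separating_section_def algebra_simps)
qed

lemma separating_section_small_on_curve:
  assumes y: "y \<in> gamma0 eps c"
  shows "section_norm (Suc N) (separating_section N) y \<le> 2 ^ N * tail N"
proof -
  obtain \<zeta> where \<zeta>: "cmod \<zeta> = 1" "y = affine_pt \<zeta> (omega eps c \<zeta>)"
    using y by (auto simp: gamma0_eq)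
  have "section_norm (Suc N) (separating_section N) y
      \<le> cmod (separating_section N (vector [1, \<zeta>, omega eps c \<zeta>]))"
    unfolding \<zeta>(2) by (rule section_norm_affine_le[OF separating_section_in_sections])
  also have "\<dots> = cmod (den N 1 \<zeta>) * cmod (omega eps c \<zeta> - omega_part N \<zeta>)"
    using \<zeta>(1) by (subst separating_section_affine) (auto simp: norm_mult intro!: outside_nonpole)
  also have "\<dots> \<le> 2 ^ N * tail N"
  proof (intro mult_mono omega_minus_part_le_tail)
    have "cmod (\<zeta> - a j) \<le> 2" for j
      using norm_triangle_ineq4[of \<zeta> "a j"] \<zeta>(1) norm_a[of j] pole_lt_1[of j] by simp
    then have "cmod (den N 1 \<zeta>) \<le> (\<Prod>j<N. 2)"
      unfolding den_def prod_norm[symmetric] by (intro prod_mono) auto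
    then show "cmod (den N 1 \<zeta>) \<le> 2 ^ N"
      by simp
  qed (use \<zeta>(1) in auto)
  finally show ?thesis .
qed

end

text \<open>
  The tail has to beat \<open>K^(N\<^sup>2)\<close> for every \<open>K\<close>: at a point over \<open>z = 1\<close> the separating sections
  contain the product of the first \<open>N\<close> distances \<open>\<epsilon>\<^sub>j\<close>, which is \<open>(1/2)^(N (N + 1) / 2)\<close>.
\<close>

locale rapid_pole_curve = pole_curve +
  assumes eps_eq: "eps j = (1 / 2) ^ Suc j"
    and tail_decay: "K > 0 \<Longrightarrow> (\<lambda>N. K ^ N\<^sup>2 * tail N) \<longlonglongrightarrow> 0"
begin

text \<open>
  If the point were in the hull, the value of the section would be at most the tail times a factor
  which is geometric in \<open>N\<close>, hence below \<open>K^(N\<^sup>2)\<close> for some \<open>K\<close>.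
\<close>

lemma not_in_hull:
  assumes v: "v \<noteq> 0" and \<delta>: "0 < \<delta>" "\<delta> \<le> 1"
    and large: "\<forall>\<^sub>F N in sequentially. \<delta> * \<delta> ^ N\<^sup>2 \<le> cmod (separating_section N v)"
  shows "cproj_of v \<notin> projective_hull (gamma0 eps c)"
proof
  assume "cproj_of v \<in> projective_hull (gamma0 eps c)"
  then obtain C where C: "C > 0" "\<And>d F. d \<ge> 1 \<Longrightarrow> F \<in> sections_O d \<Longrightarrow>
      section_norm d F (cproj_of v) \<le> C ^ d * (SUP y\<in>gamma0 eps c. section_norm d F y)"
    unfolding projective_hull_def by blast
  define M where "M = max 1 (2 * C * norm v)"
  have M: "1 \<le> M" "2 * (C * norm v) \<le> M"
    by (auto simp: M_def)
  have upper: "cmod (separating_section N v) \<le> (M\<^sup>2) ^ N\<^sup>2 * tail N" if "N > 0" for N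
  proof -
    let ?S = "SUP y\<in>gamma0 eps c. section_norm (Suc N) (separating_section N) y"
    have "gamma0 eps c \<noteq> {}"
      unfolding gamma0_eq by (auto intro: exI[of _ 1])
    then have "?S \<le> 2 ^ N * tail N"
      by (intro cSUP_least separating_section_small_on_curve)
    then have "C ^ Suc N * ?S \<le> C ^ Suc N * (2 ^ N * tail N)"
      using C(1) by (intro mult_left_mono) auto
    moreover have "section_norm (Suc N) (separating_section N) (cproj_of v) \<le> C ^ Suc N * ?S"
      by (rule C(2)[OF _ separating_section_in_sections]) simp
    ultimately have "section_norm (Suc N) (separating_section N) (cproj_of v) \<le> C ^ Suc N * (2 ^ N * tail N)"
      by linarith
    then have "cmod (separating_section N v) \<le> C ^ Suc N * (2 ^ N * tail N) * norm v ^ Suc N"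
      unfolding section_norm_cproj_of[OF separating_section_in_sections v]
      using v by (subst (asm) pos_divide_le_eq) auto
    also have "\<dots> = (C * norm v) ^ Suc N * 2 ^ N * tail N"
      by (simp add: power_mult_distrib)
    also have "\<dots> \<le> (C * norm v) ^ Suc N * 2 ^ Suc N * tail N"
      using C(1) tail_nonneg[of N] by (intro mult_right_mono mult_left_mono) auto
    also have "\<dots> = (2 * (C * norm v)) ^ Suc N * tail N"
      by (simp add: power_mult_distrib)
    also have "\<dots> \<le> M ^ Suc N * tail N"
      using M C(1) tail_nonneg[of N] by (intro mult_right_mono power_mono) auto
    also have "\<dots> \<le> M ^ (2 * N\<^sup>2) * tail N"
    proof (intro mult_right_mono power_increasing M(1) tail_nonneg)
      have "Suc N \<le> 2 * N"
        using that by simp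
      also have "\<dots> \<le> 2 * N\<^sup>2"
        using that by (simp add: power2_eq_square)
      finally show "Suc N \<le> 2 * N\<^sup>2" .
    qed
    finally show ?thesis
      by (simp add: power_mult)
  qed
  have "\<forall>\<^sub>F N in sequentially. \<delta> \<le> (M\<^sup>2 / \<delta>) ^ N\<^sup>2 * tail N"
    using large eventually_gt_at_top[of 0]
  proof eventually_elim
    case (elim N)
    then have "\<delta> * \<delta> ^ N\<^sup>2 \<le> (M\<^sup>2) ^ N\<^sup>2 * tail N"
      using upper[of N] by linarith
    then show ?case
      using \<delta>(1) by (simp add: power_divide pos_le_divide_eq)
  qed
  moreover have "(\<lambda>N. (M\<^sup>2 / \<delta>) ^ N\<^sup>2 * tail N) \<longlonglongrightarrow> 0"
    using M(1) \<delta>(1) by (intro tail_decay) auto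
  ultimately have "\<delta> \<le> 0"
    by (intro tendsto_lowerbound) auto
  then show False
    using \<delta>(1) by simp
qed

lemma pole_products_bounded_below:
  obtains \<eta> where "\<eta> > 0" "\<eta> \<le> 1"
    "\<And>N A. A \<subseteq> {..<N} \<Longrightarrow> z \<notin> a ` A \<Longrightarrow> \<eta> ^ N\<^sup>2 \<le> cmod (\<Prod>j\<in>A. z - a j)"
proof -
  obtain \<delta> where \<delta>: "\<delta> > 0" "\<delta> \<le> 1" "\<And>j. z \<noteq> a j \<Longrightarrow> \<delta> * eps j \<le> cmod (z - a j)"
    by (rule pole_distance) blast
  show ?thesis
  proof
    fix N A
    assume A: "A \<subseteq> {..<N}" "z \<notin> a ` A"
    show "(\<delta> / 2) ^ N\<^sup>2 \<le> cmod (\<Prod>j\<in>A. z - a j)"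
      unfolding prod_norm[symmetric]
    proof (rule prod_geometric_lower_bound[OF A(1)])
      fix j assume "j \<in> A"
      have "(\<delta> / 2) ^ Suc j = \<delta> ^ Suc j * eps j"
        by (simp add: eps_eq power_divide power_one_over field_simps)
      also have "\<dots> \<le> \<delta> ^ 1 * eps j"
        using \<delta> eps_pos[of j] by (intro mult_right_mono power_decreasing) auto
      also have "\<dots> \<le> cmod (z - a j)"
        using \<delta>(3)[of j] A(2) \<open>j \<in> A\<close> by auto
      finally show "(\<delta> / 2) ^ Suc j \<le> cmod (z - a j)" .
    qed (use \<delta> in auto)
  qed (use \<delta> in auto)
qed

text \<open>
  Over a pole the separating sections do not see \<open>w\<close> at all: their value there is the residue times a
  product of distances between poles.  Elsewhere they are such a product times \<open>w - \<omega>\<^sub>N(z)\<close>.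
\<close>

lemma hull_affine:
  assumes hull: "affine_pt z w \<in> projective_hull (gamma0 eps c)"
  shows "z \<notin> range a \<and> w = omega eps c z"
proof -
  obtain \<eta> where \<eta>: "\<eta> > 0" "\<eta> \<le> 1"
    "\<And>N A. A \<subseteq> {..<N} \<Longrightarrow> z \<notin> a ` A \<Longrightarrow> \<eta> ^ N\<^sup>2 \<le> cmod (\<Prod>j\<in>A. z - a j)"
    by (rule pole_products_bounded_below) blast
  have no_lower_bound: "\<not> (\<forall>\<^sub>F N in sequentially. \<gamma> * \<eta> ^ N\<^sup>2 \<le> cmod (separating_section N (vector [1, z, w])))"
    if \<gamma>: "\<gamma> > 0" for \<gamma>
  proof
    assume *: "\<forall>\<^sub>F N in sequentially. \<gamma> * \<eta> ^ N\<^sup>2 \<le> cmod (separating_section N (vector [1, z, w]))"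
    have "affine_pt z w \<notin> projective_hull (gamma0 eps c)"
      unfolding affine_pt_def
    proof (rule not_in_hull[of _ "min \<gamma> \<eta>"])
      show "\<forall>\<^sub>F N in sequentially. min \<gamma> \<eta> * min \<gamma> \<eta> ^ N\<^sup>2 \<le> cmod (separating_section N (vector [1, z, w]))"
        using *
      proof eventually_elim
        case (elim N)
        have "min \<gamma> \<eta> * min \<gamma> \<eta> ^ N\<^sup>2 \<le> \<gamma> * \<eta> ^ N\<^sup>2"
          using \<gamma> \<eta> by (intro mult_mono power_mono) auto
        then show ?case
          using elim by linarith
      qed
    qed (use \<gamma> \<eta> in auto)
    then show False
      using hull by blast
  qed
  have z: "z \<notin> range a"
  proof
    assume "z \<in> range a"
    then obtain k where k: "z = a k"
      by blast
    have "\<forall>\<^sub>F N in sequentially. c k * \<eta> ^ N\<^sup>2 \<le> cmod (separating_section N (vector [1, z, w]))"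
      using eventually_gt_at_top[of k]
    proof eventually_elim
      case (elim N)
      have "\<eta> ^ N\<^sup>2 \<le> cmod (\<Prod>i\<in>{..<N}-{k}. z - a i)"
        by (intro \<eta>(3)) (auto simp: k pole_eq_iff)
      then show ?case
        using c_pos[of k] den_at_pole[OF elim] num_at_pole[OF elim]
        by (simp add: separating_section_def k norm_mult)
    qed
    then show False
      using no_lower_bound[OF c_pos[of k]] by blast
  qed
  moreover have "w = omega eps c z"
  proof (rule ccontr)
    assume w: "w \<noteq> omega eps c z"
    define \<gamma> where "\<gamma> = cmod (w - omega eps c z) / 2"
    have "\<gamma> > 0" "\<gamma> < cmod (w - omega eps c z)"
      using w by (auto simp: \<gamma>_def)
    have "(\<lambda>N. cmod (w - omega_part N z)) \<longlonglongrightarrow> cmod (w - omega eps c z)"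
      by (intro tendsto_intros omega_part_tendsto[OF z])
    then have "\<forall>\<^sub>F N in sequentially. \<gamma> < cmod (w - omega_part N z)"
      using \<open>\<gamma> < _\<close> by (rule order_tendstoD)
    then have "\<forall>\<^sub>F N in sequentially. \<gamma> * \<eta> ^ N\<^sup>2 \<le> cmod (separating_section N (vector [1, z, w]))"
    proof eventually_elim
      case (elim N)
      have "\<eta> ^ N\<^sup>2 \<le> cmod (den N 1 z)"
        unfolding den_def using z \<eta>(3)[of "{..<N}" N] by auto
      then have "\<eta> ^ N\<^sup>2 * \<gamma> \<le> cmod (den N 1 z) * cmod (w - omega_part N z)"
        using elim \<open>\<gamma> > 0\<close> by (intro mult_mono) auto
      then show ?case
        by (simp add: separating_section_affine[OF z] norm_mult mult.commute)
    qed
    then show False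
      using no_lower_bound[OF \<open>\<gamma> > 0\<close>] by blast
  qed
  ultimately show ?thesis ..
qed

lemma hull_at_infinity:
  assumes hull: "cproj_of (vector [0, 1, w]) \<in> projective_hull (gamma0 eps c)"
  shows "w = 0"
proof (rule ccontr)
  assume "w \<noteq> 0"
  let ?\<delta> = "min 1 (cmod w)"
  have "separating_section N (vector [0, 1, w]) = w" for N
    by (simp add: separating_section_def den_def num_def)
  moreover have "?\<delta> * ?\<delta> ^ N\<^sup>2 \<le> cmod w * 1" for N
    by (intro mult_mono power_le_one) auto
  ultimately have "cproj_of (vector [0, 1, w]) \<notin> projective_hull (gamma0 eps c)"
    using \<open>w \<noteq> 0\<close> by (intro not_in_hull[of _ ?\<delta>]) (auto simp: vector3_nonzero)
  then show False
    using hull by blast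
qed

lemma hull_eq: "projective_hull (gamma0 eps c) = curve_W eps c \<union> {pt_ell, pt_p eps c}"
proof
  show "projective_hull (gamma0 eps c) \<subseteq> curve_W eps c \<union> {pt_ell, pt_p eps c}"
  proof
    fix x assume x: "x \<in> projective_hull (gamma0 eps c)"
    show "x \<in> curve_W eps c \<union> {pt_ell, pt_p eps c}"
    proof (cases x rule: plane_cases)
      case (affine z w)
      then have "z \<notin> range a" "w = omega eps c z"
        using hull_affine x by auto
      then show ?thesis
        unfolding affine curve_W_points graph_omega_def pt_p_def by auto
    next
      case (infinity w)
      then show ?thesis
        using hull_at_infinity x by (auto simp: curve_W_points pt_horizontal_def)
    qed simp
  qed
qed (rule curve_W_subset_hull)

section \<open>Density of the graph near the line\<close>

text \<open>
  The distances of the poles to \<open>1\<close> are distinct powers of \<open>1/2\<close>, so they differ by a factor of at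
  least \<open>2\<close>.
\<close>

lemma eps_separation:
  assumes "i \<noteq> j"
  shows "eps i / 2 \<le> cmod (a i - a j)" "eps j / 2 \<le> cmod (a i - a j)"
proof -
  have halving: "eps j \<le> eps i / 2" if "i < j" for i j
  proof -
    have "(1 / 2 :: real) ^ Suc j \<le> (1 / 2) ^ Suc (Suc i)"
      using that by (intro power_decreasing) auto
    then show ?thesis
      by (simp add: eps_eq)
  qed
  have dist: "cmod (a i - a j) = \<bar>eps j - eps i\<bar>"
    by (simp add: pole_def flip: of_real_diff)
  consider "i < j" | "j < i"
    using assms by linarith
  then show "eps i / 2 \<le> cmod (a i - a j)" "eps j / 2 \<le> cmod (a i - a j)"
    unfolding dist using halving[of i j] halving[of j i] eps_pos[of i] eps_pos[of j] by (cases; auto)+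
qed

text \<open>
  The points \<open>\<zeta>\<^sub>j = a\<^sub>j + h\<^sub>j\<close> are chosen such that the singular term \<open>c\<^sub>j / h\<^sub>j\<close> equals \<open>w - \<omega>(1)\<close>.
  Because \<open>c\<^sub>j / \<epsilon>\<^sub>j\<close> tends to \<open>0\<close>, they are eventually so close to \<open>a\<^sub>j\<close> that the other terms behave
  as at \<open>a\<^sub>j\<close>, and their sum tends to \<open>\<omega>(1)\<close>.  For \<open>w = \<omega>(1)\<close> the equation for \<open>h\<^sub>j\<close>
  has no solution, but that value is a limit of others.
\<close>

lemma line_point_in_closure_graph:
  assumes w: "w \<noteq> omega eps c 1"
  shows "(1, w) \<in> closure graph_set"
proof -
  define h where "h j = of_real (c j) / (w - omega eps c 1)" for j
  define \<zeta> where "\<zeta> j = a j + h j" for j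
  have h_nz: "h j \<noteq> 0" for j
    using w c_pos[of j] by (simp add: h_def)
  have h_quot: "of_real (c j) / h j = w - omega eps c 1" for j
    using w c_pos[of j] by (simp add: h_def)
  have "(\<lambda>j. c j / eps j) \<longlonglongrightarrow> 0"
    by (rule summable_LIMSEQ_zero[OF summable_c_eps])
  then have "\<forall>\<^sub>F j in sequentially. c j / eps j < cmod (w - omega eps c 1) / 4"
    using w by (intro order_tendstoD) auto
  then have h_small: "\<forall>\<^sub>F j in sequentially. cmod (h j) \<le> eps j / 4"
  proof eventually_elim
    case (elim j)
    then show ?case
      using w eps_pos[of j] c_pos[of j] by (simp add: h_def norm_divide field_simps)
  qed
  have far: "eps i / 4 \<le> cmod (\<zeta> j - a i)" if "cmod (h j) \<le> eps j / 4" "i \<noteq> j" for i j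
    using norm_triangle_ineq2[of "a j - a i" "- h j"] eps_separation[OF that(2)] that(1)
    by (simp add: \<zeta>_def norm_minus_commute algebra_simps)
  have "h \<longlonglongrightarrow> 0"
    unfolding h_def[abs_def]
    using tendsto_divide_zero[OF tendsto_of_real[OF summable_LIMSEQ_zero[OF summable_c], where 'a = complex, unfolded of_real_0]] .
  then have \<zeta>_lim: "\<zeta> \<longlonglongrightarrow> 1"
    unfolding \<zeta>_def[abs_def] using tendsto_add[OF a_tendsto_1] by fastforce
  have rest_lim: "(\<lambda>j. rest j (\<zeta> j)) \<longlonglongrightarrow> (\<Sum>i. of_real (c i) / (1 - a i))"
  proof (rule rest_tendsto)
    show "0 < (1 / 4 :: real)"
      by simp
    show "\<forall>\<^sub>F n in sequentially. \<forall>i. i \<noteq> n \<longrightarrow> 1 / 4 * eps i \<le> cmod (\<zeta> n - a i)"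
      using h_small by eventually_elim (use far in auto)
    fix i
    have "\<forall>\<^sub>F n in sequentially. of_real (c i) / (\<zeta> n - a i) = (if i = n then 0 else of_real (c i) / (\<zeta> n - a i))"
      using eventually_gt_at_top[of i] by eventually_elim auto
    moreover have "(\<lambda>n. of_real (c i) / (\<zeta> n - a i)) \<longlonglongrightarrow> of_real (c i) / (1 - a i)"
      using a_ne_1[of i] by (intro tendsto_intros \<zeta>_lim) auto
    ultimately show "(\<lambda>n. if i = n then 0 else of_real (c i) / (\<zeta> n - a i)) \<longlonglongrightarrow> of_real (c i) / (1 - a i)"
      by (rule Lim_transform_eventually[rotated])
  qed
  define K where "K = (\<Sum>i. of_real (c i / pole eps i) :: complex)"
  have nonpole: "\<forall>\<^sub>F j in sequentially. \<zeta> j \<noteq> 1 \<and> \<zeta> j \<notin> range a"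
    using h_small
  proof eventually_elim
    case (elim j)
    have "\<zeta> j \<noteq> a i" for i
      using far[OF elim, of i] h_nz[of j] eps_pos[of i] by (cases "i = j") (auto simp: \<zeta>_def)
    moreover have "\<zeta> j \<noteq> 1"
    proof
      assume "\<zeta> j = 1"
      then have "h j = 1 - a j"
        by (simp add: \<zeta>_def algebra_simps)
      then have "cmod (h j) = eps j"
        using norm_1_minus_a by simp
      then show False
        using elim eps_pos[of j] by simp
    qed
    ultimately show ?case
      by auto
  qed
  have "\<forall>\<^sub>F j in sequentially. w - omega eps c 1 + rest j (\<zeta> j) + K = omega eps c (\<zeta> j)"
    using nonpole
  proof eventually_elim
    case (elim j)
    have "\<zeta> j - a j = h j"
      by (simp add: \<zeta>_def)
    then show ?case
      using omega_split[of "\<zeta> j" j] elim by (simp add: K_def h_quot)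
  qed
  moreover have "(\<lambda>j. w - omega eps c 1 + rest j (\<zeta> j) + K)
      \<longlonglongrightarrow> w - omega eps c 1 + (\<Sum>i. of_real (c i) / (1 - a i)) + K"
    by (intro tendsto_intros rest_lim)
  ultimately have "(\<lambda>j. omega eps c (\<zeta> j)) \<longlonglongrightarrow> w - omega eps c 1 + (\<Sum>i. of_real (c i) / (1 - a i)) + K"
    by (rule Lim_transform_eventually[rotated])
  then have "(\<lambda>j. omega eps c (\<zeta> j)) \<longlonglongrightarrow> w"
    by (simp add: omega_def K_def)
  then have "(\<lambda>j. (\<zeta> j, omega eps c (\<zeta> j))) \<longlonglongrightarrow> (1, w)"
    by (intro tendsto_Pair \<zeta>_lim)
  moreover have "\<forall>\<^sub>F j in sequentially. (\<zeta> j, omega eps c (\<zeta> j)) \<in> closure graph_set"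
    using nonpole
    by eventually_elim (auto simp: graph_set_def intro!: closure_subset[THEN subsetD])
  ultimately show ?thesis
    by (intro Lim_in_closed_set[OF closed_closure]) auto
qed

lemma line_subset_closure_graph: "line_L \<subseteq> closure (graph_omega eps c)"
  unfolding line_L_def
proof (rule closure_minimal[OF _ closed_closure])
  have "closure ({1} \<times> (- {omega eps c 1})) \<subseteq> closure graph_set"
    using line_point_in_closure_graph by (intro closure_minimal) auto
  then have "(1, w) \<in> closure graph_set" for w
    by (auto simp: closure_Times closure_complement)
  then show "vertical_line 1 \<subseteq> closure (graph_omega eps c)"
    unfolding graph_omega_eq vertical_line_def using affine_pt_in_closure by blast
qed

lemma closure_hull_eq: "closure (projective_hull (gamma0 eps c)) = curve_W eps c \<union> line_L"
proof
  have p: "{pt_ell, pt_p eps c} \<subseteq> line_L"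
    using pt_ell_in_line_L by (simp add: pt_p_def affine_pt_in_line_L_iff)
  have closure_W: "curve_W eps c \<union> line_L = closure (graph_omega eps c)"
    using line_subset_closure_graph by (auto simp: curve_W_eq)
  show "closure (projective_hull (gamma0 eps c)) \<subseteq> curve_W eps c \<union> line_L"
    using p closure_W by (intro closure_minimal) (auto simp: hull_eq)
  have "graph_omega eps c \<subseteq> projective_hull (gamma0 eps c)"
    by (auto simp: hull_eq curve_W_points)
  then show "curve_W eps c \<union> line_L \<subseteq> closure (projective_hull (gamma0 eps c))"
    unfolding closure_W by (rule closure_mono)
qed

end

section \<open>A rapidly decreasing choice\<close>

definition dyadic_eps :: "nat \<Rightarrow> real" where
  "dyadic_eps j = (1 / 2) ^ Suc j"

text \<open>
  Chosen such that \<open>c\<^sub>j / \<epsilon>\<^sub>j\<close> telescopes and its tail from \<open>N\<close> on is exactly \<open>(1/2)^(N\<^sup>3)\<close>.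
\<close>

definition cubic_c :: "nat \<Rightarrow> real" where
  "cubic_c j = dyadic_eps j * ((1 / 2) ^ j ^ 3 - (1 / 2) ^ Suc j ^ 3)"

lemma cubic_tail_sums:
  "(\<lambda>j. cubic_c (j + N) / dyadic_eps (j + N)) sums (1 / 2) ^ N ^ 3"
proof -
  have "(\<lambda>j. (1 / 2 :: real) ^ j) \<longlonglongrightarrow> 0"
    by (rule LIMSEQ_realpow_zero) auto
  moreover have "\<forall>\<^sub>F j in sequentially. norm ((1 / 2 :: real) ^ (j + N) ^ 3) \<le> (1 / 2) ^ j"
  proof (intro always_eventually allI)
    fix j
    have "j + N \<le> (j + N) ^ 3"
      by (cases "j + N = 0") (simp, rule self_le_power, linarith, simp)
    then have "j \<le> (j + N) ^ 3"
      by simp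
    then show "norm ((1 / 2 :: real) ^ (j + N) ^ 3) \<le> (1 / 2) ^ j"
      by (simp add: power_decreasing norm_power)
  qed
  ultimately have "(\<lambda>j. (1 / 2 :: real) ^ (j + N) ^ 3) \<longlonglongrightarrow> 0"
    by (rule Lim_null_comparison[rotated])
  from telescope_sums'[OF this] show ?thesis
    by (simp add: cubic_c_def dyadic_eps_def)
qed

lemma dyadic_eps_pos: "0 < dyadic_eps j" and dyadic_eps_le: "dyadic_eps j \<le> 1 / 2"
  by (auto simp: dyadic_eps_def power_le_one)

lemma pole_curve_cubic: "pole_curve dyadic_eps cubic_c"
proof
  show "0 < cubic_c j" for j
  proof -
    have "(1 / 2 :: real) ^ Suc j ^ 3 < (1 / 2) ^ j ^ 3"
      by (intro power_strict_decreasing power_strict_mono) auto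
    then show ?thesis
      using dyadic_eps_pos[of j] by (simp add: cubic_c_def)
  qed
  show "inj dyadic_eps"
    by (auto simp: dyadic_eps_def inj_def power_one_over)
  show "summable dyadic_eps"
    unfolding dyadic_eps_def by (intro summable_Suc_iff[THEN iffD2] summable_geometric) simp
  show "summable (\<lambda>j. cubic_c j / dyadic_eps j)"
    using cubic_tail_sums[of 0] by (auto simp: sums_iff)
  show "dyadic_eps j < 1" for j
    using dyadic_eps_le[of j] by simp
qed (rule dyadic_eps_pos)

lemma rapid_pole_curve_cubic: "rapid_pole_curve dyadic_eps cubic_c"
proof -
  interpret pole_curve dyadic_eps cubic_c
    by (rule pole_curve_cubic)
  have tail_le: "tail N \<le> 2 * (1 / 2) ^ N ^ 3" for N
  proof -
    have s: "(\<lambda>j. cubic_c (j + N) / dyadic_eps (j + N)) sums (1 / 2) ^ N ^ 3"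
      by (rule cubic_tail_sums)
    have "tail N \<le> (\<Sum>j. 2 * (cubic_c (j + N) / dyadic_eps (j + N)))"
      unfolding tail_def
    proof (rule suminf_le)
      fix j
      have "dyadic_eps (j + N) \<le> pole dyadic_eps (j + N)"
        using dyadic_eps_le[of "j + N"] by (simp add: pole_def)
      then have "cubic_c (j + N) / pole dyadic_eps (j + N) \<le> cubic_c (j + N) / dyadic_eps (j + N)"
        using dyadic_eps_pos[of "j + N"] c_pos[of "j + N"] by (intro frac_le) auto
      then show "cubic_c (j + N) / dyadic_eps (j + N) + cubic_c (j + N) / pole dyadic_eps (j + N)
          \<le> 2 * (cubic_c (j + N) / dyadic_eps (j + N))"
        by simp
    qed (use summable_ignore_initial_segment[OF summable_tail, of N] summable_mult[OF sums_summable[OF s]] in auto)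
    also have "\<dots> = 2 * (1 / 2) ^ N ^ 3"
      using sums_mult[OF s, of 2] by (simp add: sums_iff)
    finally show ?thesis .
  qed
  show ?thesis
  proof
    show "dyadic_eps j = (1 / 2) ^ Suc j" for j
      by (rule dyadic_eps_def)
    fix K :: real
    assume "K > 0"
    obtain k where "K < 2 ^ k"
      using real_arch_pow[of 2 K] by auto
    then have k: "K \<le> 2 ^ k"
      by simp
    have bound: "K ^ N\<^sup>2 * tail N \<le> 2 * (1 / 2) ^ N" if N: "N > k" for N
    proof -
      have "K ^ N\<^sup>2 * tail N \<le> (2 ^ k) ^ N\<^sup>2 * (2 * (1 / 2) ^ N ^ 3)"
        using \<open>K > 0\<close> k tail_le[of N] tail_nonneg[of N] by (intro mult_mono power_mono) auto
      also have "\<dots> = 2 * (1 / 2) ^ (N ^ 3 - k * N\<^sup>2)"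
      proof -
        have "k * N\<^sup>2 \<le> N * N\<^sup>2"
          using N by (intro mult_right_mono) auto
        then have "k * N\<^sup>2 \<le> N ^ 3"
          by (simp add: power2_eq_square power3_eq_cube)
        then have "(1 / 2 :: real) ^ N ^ 3 = (1 / 2) ^ (N ^ 3 - k * N\<^sup>2) * (1 / 2) ^ (k * N\<^sup>2)"
          by (simp flip: power_add)
        moreover have "(2 ^ k) ^ N\<^sup>2 * (1 / 2) ^ (k * N\<^sup>2) = (1 :: real)"
          by (simp add: power_one_over flip: power_mult)
        ultimately show ?thesis
          by simp
      qed
      also have "\<dots> \<le> 2 * (1 / 2) ^ N"
      proof -
        have "N \<le> N\<^sup>2"
          by (simp add: power2_eq_square)
        also have "\<dots> \<le> (N - k) * N\<^sup>2"
          using N by simp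
        also have "\<dots> = N ^ 3 - k * N\<^sup>2"
          by (simp add: diff_mult_distrib power2_eq_square power3_eq_cube)
        finally show ?thesis
          by (intro mult_left_mono power_decreasing) auto
      qed
      finally show ?thesis .
    qed
    have "(\<lambda>N. 2 * (1 / 2 :: real) ^ N) \<longlonglongrightarrow> 0"
      by (intro tendsto_mult_right_zero LIMSEQ_realpow_zero) auto
    then show "(\<lambda>N. K ^ N\<^sup>2 * tail N) \<longlonglongrightarrow> 0"
    proof (rule tendsto_sandwich[rotated 3])
      show "\<forall>\<^sub>F N in sequentially. K ^ N\<^sup>2 * tail N \<le> 2 * (1 / 2) ^ N"
        using eventually_gt_at_top[of k] by eventually_elim (rule bound)
      show "\<forall>\<^sub>F N in sequentially. 0 \<le> K ^ N\<^sup>2 * tail N"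
        using \<open>K > 0\<close> tail_nonneg by (intro always_eventually) auto
    qed simp
  qed
qed

theorem theorem3:
  "\<exists>eps c :: nat \<Rightarrow> real.
     (\<forall>j. 0 < eps j \<and> eps j < 1) \<and> (\<forall>j. 0 < c j) \<and>
     summable eps \<and> summable (\<lambda>j. c j / eps j) \<and>
     projective_hull (gamma0 eps c) = curve_W eps c \<union> {pt_ell, pt_p eps c} \<and>
     closure (projective_hull (gamma0 eps c)) = curve_W eps c \<union> line_L"
proof -
  interpret rapid_pole_curve dyadic_eps cubic_c
    by (rule rapid_pole_curve_cubic)
  show ?thesis
    using eps_pos eps_lt_1 c_pos summable_eps summable_c_eps hull_eq closure_hull_eq by blast
qed

end
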